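(* Let $X$ be a process on $\Omega$ with time domain $T$ and values in $E$, and let $S$ be an $\mathcal F^X$-stopping time. (1) If $T=\mathbb N_0$, then $\sigma(X^S)=\mathcal F^X_S$. (2) Moreover, if $X^S$ is $\mathcal F^X_S/\mathcal E^{\otimes T}$-measurable (in particular, if it is adapted to the stopped filtration $(\mathcal F^X_{t\wedge S})_{t\in T}$) and either one of the following conditions is met: (G1) $\mathrm{Im}X^S\subset\mathrm{Im}X$; (G2) (a) $(\Omega,\mathcal G)$ is Blackwell for some $\sigma$-field $\mathcal G\supset\mathcal F^X_\infty$; (b) $\sigma(X^S)$ is separable; and (c) $(\mathrm{Im}X^S,\mathcal E^{\otimes T}|_{\mathrm{Im}X^S})$ is Hausdorff; then for $A\subset\Omega$ the following statements are equivalent: (i) $A\in\mathcal F^X_S$. (ii) $\mathbb 1_A$ is constant on every set on which $X^S$ is constant, and $A\in\mathcal F^X_\infty$. (iii) $A\in\sigma(X^S)$.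
   Context: $T$ is either $\mathbb N_0$ or $[0,\infty)$ (when $T=\mathbb N_0$, $[0,t]$ denotes $\{0,\dots,t\}$), $\Omega$ is a set and $(E,\mathcal E)$ is a measurable space. A process is a collection $X=(X_t)_{t\in T}$ of functions $\Omega\to E$, equivalently a map $X:\Omega\to E^T$; its range is $\mathrm{Im}X\subset E^T$. Its natural filtration is $\mathcal F^X=(\mathcal F^X_t)_{t\in T}$, $\mathcal F^X_t:=\sigma(X_s:s\in[0,t])$, and $\mathcal F^X_\infty:=\bigvee_{t\in T}\mathcal F^X_t$. A time is a map $S:\Omega\to T\cup\{\infty\}$; the stopped process is $X^S_t(\omega):=X_{S(\omega)\wedge t}(\omega)$, and $\sigma(X^S)$ is the $\sigma$-field generated by $X^S:\Omega\to(E^T,\mathcal E^{\otimes T})$. For a filtration $\mathcal G$, $S$ is a $\mathcal G$-stopping time if $\{S\le t\}\in\mathcal G_t$ for all $t\in T$, and then $\mathcal G_S:=\{A\in\mathcal G_\infty:A\cap\{S\le t\}\in\mathcal G_t\ \forall t\in T\}$. $\mathcal L|_A:=\{L\cap A:L\in\mathcal L\}$ denotes the trace. The atoms of a measurable space $(\Omega,\mathcal F)$ are the equivalence classes of the relation $\omega\sim\omega'\Leftrightarrow(\mathbb 1_A(\omega)=\mathbb 1_A(\omega')\ \forall A\in\mathcal F)$; its Hausdorff space is the corresponding quotient measurable space. $(\Omega,\mathcal F)$ is separable if $\mathcal F$ is countably generated; Hausdorff if its atoms are singletons; Blackwell if its associated Hausdorff space is Souslin, i.e. Borel isomorphic to a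 Souslin topological space (a Hausdorff topological space that is a continuous image of a Polish space). Here no probability measure is involved. *)

theory Defs
  imports "HOL-Probability.Probability"
begin

text \<open>
  Time is a set \<^term>\<open>T :: real set\<close>, which is \<^term>\<open>\<nat> :: real set\<close> (the non-negative integers,
  \<open>0\<close> included) or \<^term>\<open>{0..} :: real set\<close>. The values of a process matter only at times in
  \<open>T\<close> and at points of \<open>\<Omega>\<close>. A \<open>\<sigma>\<close>-field on \<open>\<Omega>\<close> is a \<^typ>\<open>'w measure\<close> with space
  \<open>\<Omega>\<close>; only its \<^const>\<open>space\<close> and \<^const>\<open>sets\<close> are used, never its measure.
\<close>

definition process :: "'w set \<Rightarrow> real set \<Rightarrow> 'e measure \<Rightarrow> (real \<Rightarrow> 'w \<Rightarrow> 'e) \<Rightarrow> bool" where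
  "process \<Omega> T E X \<longleftrightarrow> (\<forall>t\<in>T. X t \<in> \<Omega> \<rightarrow> space E)"

text \<open>
  The map \<open>\<Omega> \<rightarrow> E\<^sup>T\<close>. Points of \<open>E\<^sup>T\<close> are, as in \<^const>\<open>PiM\<close>, functions that are
  \<^const>\<open>undefined\<close> outside \<open>T\<close>.
\<close>
definition path_map :: "real set \<Rightarrow> (real \<Rightarrow> 'w \<Rightarrow> 'e) \<Rightarrow> 'w \<Rightarrow> real \<Rightarrow> 'e" where
  "path_map T X \<omega> = (\<lambda>t\<in>T. X t \<omega>)"

abbreviation path_space :: "real set \<Rightarrow> 'e measure \<Rightarrow> (real \<Rightarrow> 'e) measure" where
  "path_space T E \<equiv> PiM T (\<lambda>_. E)"

definition sigma_of :: "'w set \<Rightarrow> real set \<Rightarrow> 'e measure \<Rightarrow> (real \<Rightarrow> 'w \<Rightarrow> 'e) \<Rightarrow> 'w measure" where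
  "sigma_of \<Omega> T E X = vimage_algebra \<Omega> (path_map T X) (path_space T E)"

definition nat_filtration ::
  "'w set \<Rightarrow> real set \<Rightarrow> 'e measure \<Rightarrow> (real \<Rightarrow> 'w \<Rightarrow> 'e) \<Rightarrow> real \<Rightarrow> 'w measure" where
  "nat_filtration \<Omega> T E X t = sigma \<Omega> {X s -` B \<inter> \<Omega> | s B. s \<in> T \<and> s \<le> t \<and> B \<in> sets E}"

definition filtration_inf :: "'w set \<Rightarrow> real set \<Rightarrow> (real \<Rightarrow> 'w measure) \<Rightarrow> 'w measure" where
  "filtration_inf \<Omega> T G = sigma \<Omega> (\<Union>t\<in>T. sets (G t))"

definition random_time :: "'w set \<Rightarrow> real set \<Rightarrow> ('w \<Rightarrow> ereal) \<Rightarrow> bool" where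
  "random_time \<Omega> T S \<longleftrightarrow> S \<in> \<Omega> \<rightarrow> ereal ` T \<union> {\<infinity>}"

text \<open>
  The library's \<^const>\<open>Stopping_Time.stopping_time\<close> quantifies over a whole index type in which the
  time takes its values; here the index set is \<open>T\<close> and the values lie in \<open>T \<union> {\<infinity>}\<close>.
\<close>
definition stopping_time_on ::
  "'w set \<Rightarrow> real set \<Rightarrow> (real \<Rightarrow> 'w measure) \<Rightarrow> ('w \<Rightarrow> ereal) \<Rightarrow> bool" where
  "stopping_time_on \<Omega> T G S \<longleftrightarrow>
     random_time \<Omega> T S \<and> (\<forall>t\<in>T. {\<omega> \<in> \<Omega>. S \<omega> \<le> ereal t} \<in> sets (G t))"

definition stopped_sigma ::
  "'w set \<Rightarrow> real set \<Rightarrow> (real \<Rightarrow> 'w measure) \<Rightarrow> ('w \<Rightarrow> ereal) \<Rightarrow> 'w measure" where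
  "stopped_sigma \<Omega> T G S =
     sigma \<Omega> {A \<in> sets (filtration_inf \<Omega> T G).
               \<forall>t\<in>T. A \<inter> {\<omega> \<in> \<Omega>. S \<omega> \<le> ereal t} \<in> sets (G t)}"

definition stopped_process :: "(real \<Rightarrow> 'w \<Rightarrow> 'e) \<Rightarrow> ('w \<Rightarrow> ereal) \<Rightarrow> real \<Rightarrow> 'w \<Rightarrow> 'e" where
  "stopped_process X S t \<omega> = X (real_of_ereal (min (S \<omega>) (ereal t))) \<omega>"

definition stopped_filtration ::
  "'w set \<Rightarrow> real set \<Rightarrow> (real \<Rightarrow> 'w measure) \<Rightarrow> ('w \<Rightarrow> ereal) \<Rightarrow> real \<Rightarrow> 'w measure" where
  "stopped_filtration \<Omega> T G S t = stopped_sigma \<Omega> T G (\<lambda>\<omega>. min (ereal t) (S \<omega>))"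

definition adapted ::
  "real set \<Rightarrow> (real \<Rightarrow> 'w measure) \<Rightarrow> 'e measure \<Rightarrow> (real \<Rightarrow> 'w \<Rightarrow> 'e) \<Rightarrow> bool" where
  "adapted T G E X \<longleftrightarrow> (\<forall>t\<in>T. X t \<in> G t \<rightarrow>\<^sub>M E)"

text \<open>In \<^const>\<open>stopped_sigma\<close> the operator \<^const>\<open>sigma\<close> adds no sets.\<close>

lemma sets_stopped_sigma:
  assumes sp: "\<And>t. t \<in> T \<Longrightarrow> space (G t) = \<Omega>" and S: "stopping_time_on \<Omega> T G S"
  shows "sets (stopped_sigma \<Omega> T G S) =
    {A \<in> sets (filtration_inf \<Omega> T G). \<forall>t\<in>T. A \<inter> {\<omega> \<in> \<Omega>. S \<omega> \<le> ereal t} \<in> sets (G t)}"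
    (is "_ = ?C")
proof -
  let ?F = "filtration_inf \<Omega> T G"
  have "(\<Union>t\<in>T. sets (G t)) \<subseteq> Pow \<Omega>"
    using sets.space_closed sp by blast
  then have spF: "space ?F = \<Omega>"
    by (simp add: filtration_inf_def space_measure_of)
  have "sigma_algebra \<Omega> ?C"
    unfolding sigma_algebra_iff2
  proof (intro conjI ballI allI impI)
    show "?C \<subseteq> Pow \<Omega>"
      using sets.sets_into_space[of _ ?F] spF by auto
    show "{} \<in> ?C" by simp
  next
    fix A assume A: "A \<in> ?C"
    have "(\<Omega> - A) \<inter> {\<omega> \<in> \<Omega>. S \<omega> \<le> ereal t} \<in> sets (G t)" if "t \<in> T" for t
    proof -
      have "(\<Omega> - A) \<inter> {\<omega> \<in> \<Omega>. S \<omega> \<le> ereal t} =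
          {\<omega> \<in> \<Omega>. S \<omega> \<le> ereal t} - A \<inter> {\<omega> \<in> \<Omega>. S \<omega> \<le> ereal t}" by auto
      then show ?thesis using A S that by (auto simp: stopping_time_on_def)
    qed
    moreover have "\<Omega> - A \<in> sets ?F" using A spF sets.compl_sets[of A ?F] by auto
    ultimately show "\<Omega> - A \<in> ?C" by blast
  next
    fix A :: "nat \<Rightarrow> 'a set" assume A: "range A \<subseteq> ?C"
    have "(\<Union>i. A i) \<inter> {\<omega> \<in> \<Omega>. S \<omega> \<le> ereal t} \<in> sets (G t)" if "t \<in> T" for t
    proof -
      have "(\<Union>i. A i \<inter> {\<omega> \<in> \<Omega>. S \<omega> \<le> ereal t}) \<in> sets (G t)"
        using A that by (intro sets.countable_UN) auto
      then show ?thesis by simp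
    qed
    moreover have "(\<Union>i. A i) \<in> sets ?F" using A by (intro sets.countable_UN) auto
    ultimately show "(\<Union>i. A i) \<in> ?C" by blast
  qed
  then show ?thesis
    unfolding stopped_sigma_def by (rule sigma_algebra.sets_measure_of_eq)
qed

definition separable_measurable :: "'a measure \<Rightarrow> bool" where
  "separable_measurable M \<longleftrightarrow>
     (\<exists>C. countable C \<and> C \<subseteq> Pow (space M) \<and> sets M = sigma_sets (space M) C)"

definition atom_rel :: "'a measure \<Rightarrow> ('a \<times> 'a) set" where
  "atom_rel M = {(x, y) \<in> space M \<times> space M. \<forall>A\<in>sets M. indicator A x = (indicator A y :: real)}"

definition atoms :: "'a measure \<Rightarrow> 'a set set" where
  "atoms M = space M // atom_rel M"

definition Hausdorff_quotient :: "'a measure \<Rightarrow> 'a set measure" where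
  "Hausdorff_quotient M =
     sigma (atoms M) {B. B \<subseteq> atoms M \<and> {x \<in> space M. atom_rel M `` {x} \<in> B} \<in> sets M}"

definition Hausdorff_measurable :: "'a measure \<Rightarrow> bool" where
  "Hausdorff_measurable M \<longleftrightarrow> (\<forall>a\<in>atoms M. \<exists>x. a = {x})"

definition borel_of :: "'a topology \<Rightarrow> 'a measure" where
  "borel_of Y = sigma (topspace Y) {U. openin Y U}"

definition measurable_isomorphic :: "'a measure \<Rightarrow> 'b measure \<Rightarrow> bool" where
  "measurable_isomorphic M N \<longleftrightarrow>
     (\<exists>f g. f \<in> M \<rightarrow>\<^sub>M N \<and> g \<in> N \<rightarrow>\<^sub>M M \<and>
            (\<forall>x\<in>space M. g (f x) = x) \<and> (\<forall>y\<in>space N. f (g y) = y))"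

definition Polish_topology :: "'a topology \<Rightarrow> bool" where
  "Polish_topology Z \<longleftrightarrow> separable_space Z \<and> completely_metrizable_space Z"

text \<open>
  A definition cannot quantify over types. The Polish space is therefore an arbitrary topology
  whose points are real numbers (not the usual topology of the reals). Every Polish topology is
  homeomorphic to one of these, so nothing is lost: see \<open>Souslin_topologyI\<close> below.
\<close>
definition Souslin_topology :: "'a topology \<Rightarrow> bool" where
  "Souslin_topology Y \<longleftrightarrow> Hausdorff_space Y \<and>
     (\<exists>(Z :: real topology) f. Polish_topology Z \<and> continuous_map Z Y f \<and>
        f ` topspace Z = topspace Y)"

text \<open>
  Similarly, the points of the Souslin topology have the type of the points of the Hausdorff
  quotient; by \<open>Blackwell_measurableI\<close> below, nothing is lost.
\<close>
definition Blackwell_measurable :: "'a measure \<Rightarrow> bool" where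
  "Blackwell_measurable M \<longleftrightarrow>
     (\<exists>Y :: 'a set topology. Souslin_topology Y \<and>
        measurable_isomorphic (Hausdorff_quotient M) (borel_of Y))"

lemma sets_Hausdorff_quotient:
  "sets (Hausdorff_quotient M) =
     {B. B \<subseteq> atoms M \<and> {x \<in> space M. atom_rel M `` {x} \<in> B} \<in> sets M}" (is "_ = ?C")
proof -
  have "sigma_algebra (atoms M) ?C"
    unfolding sigma_algebra_iff2
  proof (intro conjI ballI allI impI)
    fix B assume B: "B \<in> ?C"
    have "{x \<in> space M. atom_rel M `` {x} \<in> atoms M - B} =
        space M - {x \<in> space M. atom_rel M `` {x} \<in> B}"
      by (auto simp: atoms_def intro: quotientI)
    then show "atoms M - B \<in> ?C" using B by auto
  next
    fix B :: "nat \<Rightarrow> 'a set set" assume B: "range B \<subseteq> ?C"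
    have "(\<Union>i. {x \<in> space M. atom_rel M `` {x} \<in> B i}) \<in> sets M"
      using B by (intro sets.countable_UN) auto
    moreover have "(\<Union>i. {x \<in> space M. atom_rel M `` {x} \<in> B i}) =
        {x \<in> space M. atom_rel M `` {x} \<in> (\<Union>i. B i)}" by auto
    ultimately show "(\<Union>i. B i) \<in> ?C" using B by auto
  qed auto
  then show ?thesis
    unfolding Hausdorff_quotient_def by (rule sigma_algebra.sets_measure_of_eq)
qed

lemma space_Hausdorff_quotient: "space (Hausdorff_quotient M) = atoms M"
  by (simp add: Hausdorff_quotient_def space_measure_of_conv)

lemma homeomorphic_transport:
  fixes Z :: "'z topology" and h :: "'z \<Rightarrow> 'y"
  assumes h: "inj_on h (topspace Z)"
  obtains Z' where "homeomorphic_map Z Z' h"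
proof -
  let ?o = "\<lambda>V. V \<subseteq> h ` topspace Z \<and> openin Z {x \<in> topspace Z. h x \<in> V}"
  have "istopology ?o"
    unfolding istopology_def
  proof (intro conjI allI impI)
    fix V W assume "?o V" "?o W"
    moreover have "{x \<in> topspace Z. h x \<in> V \<inter> W} =
      {x \<in> topspace Z. h x \<in> V} \<inter> {x \<in> topspace Z. h x \<in> W}" by auto
    ultimately show "openin Z {x \<in> topspace Z. h x \<in> V \<inter> W}" by auto
  next
    fix K assume "\<forall>V\<in>K. ?o V"
    moreover have "{x \<in> topspace Z. h x \<in> \<Union>K} = (\<Union>V\<in>K. {x \<in> topspace Z. h x \<in> V})" by auto
    ultimately show "openin Z {x \<in> topspace Z. h x \<in> \<Union>K}" by auto
  qed auto
  then have op: "openin (topology ?o) V \<longleftrightarrow> ?o V" for V by (simp add: topology_inverse')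
  have top: "topspace (topology ?o) = h ` topspace Z"
  proof -
    have "{x \<in> topspace Z. h x \<in> h ` topspace Z} = topspace Z" by auto
    then have "openin (topology ?o) (h ` topspace Z)" by (simp add: op)
    then show ?thesis
      using op openin_topspace[of "topology ?o"] by (meson openin_subset subset_antisym)
  qed
  have "homeomorphic_map Z (topology ?o) h"
  proof (intro bijective_open_imp_homeomorphic_map conjI)
    show "continuous_map Z (topology ?o) h" unfolding continuous_map_def using op top by auto
    show "open_map Z (topology ?o) h"
      unfolding open_map_def
    proof (intro allI impI)
      fix U assume U: "openin Z U"
      have "{x \<in> topspace Z. h x \<in> h ` U} = U"
        using h openin_subset[OF U] by (auto simp: inj_on_def)
      then show "openin (topology ?o) (h ` U)" using U openin_subset[OF U] op by auto
    qed
  qed (use h top in auto)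
  then show ?thesis using that by blast
qed

lemma Polish_topology_inj_real:
  assumes "Polish_topology Z"
  obtains h :: "'z \<Rightarrow> real" where "inj_on h (topspace Z)"
proof -
  obtain M d where "Metric_space M d" and Z: "Z = Metric_space.mtopology M d"
    using assms by (auto simp: Polish_topology_def completely_metrizable_space_def)
  then interpret Metric_space M d by simp
  obtain C where C: "countable C" "C \<subseteq> M" "mtopology closure_of C = M"
    using assms Z by (auto simp: Polish_topology_def separable_space_def)
  define k where "k x = {(c, q :: rat). c \<in> C \<and> d c x < of_rat q}" for x
  have inj_k: "inj_on k M"
  proof (rule inj_onI, rule ccontr)
    fix x y assume xy: "x \<in> M" "y \<in> M" "k x = k y" "x \<noteq> y"
    then have "0 < d x y / 2" by simp
    then obtain q where q: "0 < (of_rat q :: real)" "of_rat q < d x y / 2"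
      using of_rat_dense by blast
    have "x \<in> mtopology closure_of C" using C xy by simp
    then have "\<exists>c\<in>C. c \<in> mball x (of_rat q)"
      using q by (simp add: metric_closure_of)
    then obtain c where c: "c \<in> C" "c \<in> mball x (of_rat q)" by blast
    then have "(c, q) \<in> k x" by (auto simp: k_def commute)
    then have "d c y < of_rat q" using xy by (auto simp: k_def)
    moreover have "d x y \<le> d x c + d c y" using triangle xy c by auto
    ultimately show False using c q by auto
  qed
  have "inj_on (image (to_nat_on (C \<times> (UNIV :: rat set)))) (k ` M)"
    by (rule inj_on_subset[OF inj_on_image_Pow[OF inj_on_to_nat_on]]) (auto simp: C k_def)
  moreover obtain e :: "nat set \<Rightarrow> real" where "inj e"
    using nat_sets_eqpoll_reals by (auto simp: eqpoll_def bij_betw_def)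
  ultimately have "inj_on (e \<circ> (image (to_nat_on (C \<times> (UNIV :: rat set))) \<circ> k)) M"
    using inj_k by (intro comp_inj_on) (auto intro: inj_on_subset)
  then show ?thesis using that Z by simp
qed

lemma Souslin_topologyI:
  fixes Z :: "'z topology"
  assumes Y: "Hausdorff_space Y" and Z: "Polish_topology Z"
    and f: "continuous_map Z Y f" "f ` topspace Z = topspace Y"
  shows "Souslin_topology Y"
proof -
  obtain h :: "'z \<Rightarrow> real" where "inj_on h (topspace Z)"
    using Polish_topology_inj_real[OF Z] .
  then obtain Z' where h: "homeomorphic_map Z Z' h" by (rule homeomorphic_transport)
  then obtain k where k: "homeomorphic_maps Z Z' h k" by (auto simp: homeomorphic_map_maps)
  have "Z homeomorphic_space Z'" using k by (auto simp: homeomorphic_space_def)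
  then have "Polish_topology Z'"
    using Z homeomorphic_separable_space[of Z Z'] homeomorphic_completely_metrizable_space[of Z Z']
    by (simp add: Polish_topology_def)
  moreover have "continuous_map Z' Y (f \<circ> k)"
    using k f(1) continuous_map_compose unfolding homeomorphic_maps_def by blast
  moreover have "k ` topspace Z' = topspace Z"
    using homeomorphic_imp_surjective_map[OF homeomorphic_maps_imp_map[OF homeomorphic_maps_sym[THEN iffD1, OF k]]] .
  then have "(f \<circ> k) ` topspace Z' = topspace Y"
    using f by (metis image_comp)
  ultimately show ?thesis using Y unfolding Souslin_topology_def by blast
qed

lemma space_borel_of: "space (borel_of Y) = topspace Y"
  by (simp add: borel_of_def space_measure_of_conv)

lemma continuous_map_borel_of:
  assumes "continuous_map Y Y' h"
  shows "h \<in> borel_of Y \<rightarrow>\<^sub>M borel_of Y'"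
proof -
  have sub: "{U. openin W U} \<subseteq> Pow (topspace W)" for W :: "'c topology"
    using openin_subset by blast
  show ?thesis
    unfolding borel_of_def
  proof (rule measurable_sigma_sets[OF sets_measure_of[OF sub] sub])
    show "h \<in> space (sigma (topspace Y) {U. openin Y U}) \<rightarrow> topspace Y'"
      using assms by (simp add: continuous_map_def space_measure_of_conv Pi_iff)
    fix U assume "U \<in> {U. openin Y' U}"
    then have "openin Y {x \<in> topspace Y. h x \<in> U}"
      using assms by (simp add: continuous_map_def)
    moreover have "{x \<in> topspace Y. h x \<in> U} = h -` U \<inter> topspace Y" by auto
    ultimately show "h -` U \<inter> space (sigma (topspace Y) {U. openin Y U}) \<in>
        sets (sigma (topspace Y) {U. openin Y U})"
      by (simp add: space_measure_of_conv sets_measure_of[OF sub] sigma_sets.Basic)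
  qed
qed

lemma Blackwell_measurableI:
  fixes M :: "'a measure" and Y :: "'y topology"
  assumes Y: "Souslin_topology Y" and iso: "measurable_isomorphic (Hausdorff_quotient M) (borel_of Y)"
  shows "Blackwell_measurable M"
proof -
  obtain f g where fg0: "f \<in> Hausdorff_quotient M \<rightarrow>\<^sub>M borel_of Y \<and>
      g \<in> borel_of Y \<rightarrow>\<^sub>M Hausdorff_quotient M \<and>
      (\<forall>x\<in>space (Hausdorff_quotient M). g (f x) = x) \<and> (\<forall>y\<in>space (borel_of Y). f (g y) = y)"
    using iso unfolding measurable_isomorphic_def by (elim exE)
  note fg = fg0[THEN conjunct1] fg0[THEN conjunct2, THEN conjunct1]
  have gf: "g (f x) = x" if "x \<in> space (Hausdorff_quotient M)" for x
    using fg0[THEN conjunct2, THEN conjunct2, THEN conjunct1] that by (rule bspec)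
  have fg': "f (g y) = y" if "y \<in> topspace Y" for y
    using fg0[THEN conjunct2, THEN conjunct2, THEN conjunct2, unfolded space_borel_of] that
    by (rule bspec)
  have "inj_on g (topspace Y)" by (rule inj_on_inverseI[where g = f]) (rule fg')
  then obtain Y' where g: "homeomorphic_map Y Y' g" by (rule homeomorphic_transport)
  then obtain k where k: "homeomorphic_maps Y Y' g k" by (auto simp: homeomorphic_map_maps)
  obtain Z :: "real topology" and p where p: "Polish_topology Z" "continuous_map Z Y p"
      "p ` topspace Z = topspace Y"
    using Y unfolding Souslin_topology_def by (elim conjE exE)
  have "Hausdorff_space Y'"
    using Y homeomorphic_Hausdorff_space[of Y Y'] homeomorphic_map_imp_homeomorphic_space[OF g]
    by (simp add: Souslin_topology_def)
  moreover have "continuous_map Z Y' (g \<circ> p)"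
    by (rule continuous_map_compose[OF p(2) homeomorphic_imp_continuous_map[OF g]])
  moreover have "(g \<circ> p) ` topspace Z = topspace Y'"
    by (simp only: image_comp[symmetric] p(3) homeomorphic_imp_surjective_map[OF g])
  ultimately have "Souslin_topology Y'" using p(1) by (intro Souslin_topologyI)
  moreover have "measurable_isomorphic (Hausdorff_quotient M) (borel_of Y')"
    unfolding measurable_isomorphic_def
  proof (intro exI conjI ballI)
    have gk: "g \<in> borel_of Y \<rightarrow>\<^sub>M borel_of Y'" "k \<in> borel_of Y' \<rightarrow>\<^sub>M borel_of Y"
      using k by (simp_all add: homeomorphic_maps_def continuous_map_borel_of)
    show "g \<circ> f \<in> Hausdorff_quotient M \<rightarrow>\<^sub>M borel_of Y'"
      by (rule measurable_comp[OF fg(1) gk(1)])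
    show "g \<circ> k \<in> borel_of Y' \<rightarrow>\<^sub>M Hausdorff_quotient M"
      by (rule measurable_comp[OF gk(2) fg(2)])
    show "(g \<circ> k) ((g \<circ> f) x) = x" if "x \<in> space (Hausdorff_quotient M)" for x
    proof -
      have "f x \<in> topspace Y" using measurable_space[OF fg(1) that] by (simp add: space_borel_of)
      then have "k (g (f x)) = f x" using k by (simp add: homeomorphic_maps_def)
      then show ?thesis by (simp only: o_apply gf[OF that])
    qed
    show "(g \<circ> f) ((g \<circ> k) y) = y" if "y \<in> space (borel_of Y')" for y
    proof -
      have "k y \<in> topspace Y" using measurable_space[OF gk(2) that] by (simp add: space_borel_of)
      then have "f (g (k y)) = k y" by (rule fg')
      moreover have "g (k y) = y" using k that by (simp add: homeomorphic_maps_def space_borel_of)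
      ultimately show ?thesis by (simp only: o_apply)
    qed
  qed
  ultimately show ?thesis unfolding Blackwell_measurable_def by blast
qed

end

theory Submission
  imports Defs
begin

text \<open>
  If two outcomes have the same stopped path, then at every time up to \<open>S\<close> they lie in the same atom
  of the natural filtration; so they have the same value of \<open>S\<close>, and no set of \<open>F\<^sub>S\<close> separates them.
  Conversely, let \<open>A\<close> in \<open>F\<^sub>\<infinity>\<close> be a union of level sets of \<open>X\<^sup>S\<close>. If every stopped path is the full
  path of some outcome, replacing an outcome by such an outcome is a measurable operation that
  preserves \<open>A\<close>. In the Blackwell case the level sets of \<open>X\<^sup>S\<close> are the atoms of the countably
  generated \<open>\<sigma>(X\<^sup>S)\<close>, and Blackwell's theorem applies: it follows from Lusin's separation theorem after
  everything is pulled back to a closed set of sequences of natural numbers. In discrete time the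
  trace of \<open>F\<^sub>n\<close> on \<open>{S \<ge> n}\<close> is contained in \<open>\<sigma>(X\<^sup>S)\<close>, by induction on \<open>n\<close>.
\<close>

subsection \<open>Borel sets, analytic sets and Lusin separation\<close>

text \<open>
  The library topology of \<^typ>\<open>nat\<close> comes without a metric; with this one, \<^typ>\<open>nat \<Rightarrow> nat\<close> is an
  instance of \<^class>\<open>polish_space\<close>.
\<close>

instantiation nat :: metric_space
begin

definition dist_nat :: "nat \<Rightarrow> nat \<Rightarrow> real" where
  "dist_nat m n = \<bar>real m - real n\<bar>"

definition uniformity_nat :: "(nat \<times> nat) filter" where
  "uniformity_nat = (INF e\<in>{0 <..}. principal {(x, y). dist x y < e})"

lemma dist_nat_less_1_iff: "dist m n < 1 \<longleftrightarrow> m = n" for m n :: nat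
  unfolding dist_nat_def by linarith

instance
proof
  fix U :: "nat set"
  have "eventually (\<lambda>(x', y). x' = x \<longrightarrow> y \<in> U) uniformity" if "x \<in> U" for x
  proof -
    have "eventually (\<lambda>(x', y). x' = x \<longrightarrow> y \<in> U) (principal {(x', y). dist x' y < (1::real)})"
      using that by (auto simp: eventually_principal dist_nat_less_1_iff)
    then show ?thesis
      unfolding uniformity_nat_def by (rule filter_leD[OF INF_lower, rotated]) simp
  qed
  then show "open U \<longleftrightarrow> (\<forall>x\<in>U. eventually (\<lambda>(x', y). x' = x \<longrightarrow> y \<in> U) uniformity)"
    by (auto simp: discrete_topology_class.open_discrete)
qed (auto simp: dist_nat_def uniformity_nat_def)

end

instance nat :: polish_space
proof
  fix X :: "nat \<Rightarrow> nat" assume "Cauchy X"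
  \<comment> \<open>Distinct naturals have distance at least 1, so radius 1 already forces a Cauchy
    sequence to be eventually constant.\<close>
  then obtain M where M: "\<And>m n. m \<ge> M \<Longrightarrow> n \<ge> M \<Longrightarrow> dist (X m) (X n) < 1"
    unfolding Cauchy_def using zero_less_one by blast
  then have "\<forall>\<^sub>F n in sequentially. X n = X M"
    by (auto simp: eventually_sequentially dist_nat_less_1_iff)
  then show "convergent X" unfolding convergent_def by (blast intro: tendsto_eventually)
qed

text \<open>Analytic sets are encoded as projections of closed sets along Baire space, so that
  countable operations on them become recodings of the sequence coordinate.\<close>

definition analytic_set :: "'a::topological_space set \<Rightarrow> bool" where
  "analytic_set A \<longleftrightarrow> (\<exists>F :: ('a \<times> (nat \<Rightarrow> nat)) set. closed F \<and> A = fst ` F)"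

lemma analytic_set_closed:
  assumes "closed A"
  shows "analytic_set A"
proof -
  have "closed (A \<times> (UNIV :: (nat \<Rightarrow> nat) set))"
    using assms by (intro closed_Times) auto
  moreover have "A = fst ` (A \<times> (UNIV :: (nat \<Rightarrow> nat) set))" by auto
  ultimately show ?thesis unfolding analytic_set_def by blast
qed

lemma closed_vimage_continuous:
  assumes "closed F" "continuous_on UNIV g"
  shows "closed {x. g x \<in> F}"
  using closed_vimage[OF assms] by (simp add: vimage_def)

lemma continuous_on_apply: "continuous_on UNIV (\<lambda>p :: 'a::topological_space \<times> (nat \<Rightarrow> nat). snd p i)"
  by (rule continuous_on_product_then_coordinatewise[OF continuous_on_snd[OF continuous_on_id]])

lemma closed_snd_apply:
  fixes i :: nat
  shows "closed {p :: 'a::topological_space \<times> (nat \<Rightarrow> nat). snd p 0 \<noteq> i}"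
proof -
  have "closed (- {i})" unfolding closed_def by (rule discrete_topology_class.open_discrete)
  from closed_vimage_continuous[OF this continuous_on_apply] show ?thesis by simp
qed

text \<open>The first entry of the sequence names an index \<open>i\<close>, and the tail is a
  witness for membership in \<open>A i\<close>. The set \<open>?G\<close> expresses this as a
  conjunction of implications, one for each \<open>i\<close>; each of them is closed because the
  first entry ranges over a discrete space.\<close>

lemma analytic_set_UN:
  assumes "\<And>i::nat. analytic_set (A i)"
  shows "analytic_set (\<Union>i. A i)"
proof -
  obtain F where F: "\<And>i. closed (F i)" "\<And>i. A i = fst ` (F i :: ('a \<times> (nat \<Rightarrow> nat)) set)"
    using assms unfolding analytic_set_def by metis
  let ?G = "\<Inter>i. {p :: 'a \<times> (nat \<Rightarrow> nat). snd p 0 \<noteq> i} \<union> {p. (fst p, \<lambda>k. snd p (Suc k)) \<in> F i}"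
  have "closed ?G"
    by (intro closed_INT ballI closed_Un closed_snd_apply closed_vimage_continuous F
        continuous_on_Pair continuous_on_fst continuous_on_id continuous_on_coordinatewise_then_product
        continuous_on_apply)
  moreover have "(\<Union>i. A i) = fst ` ?G"
  proof (intro equalityI subsetI)
    fix x assume "x \<in> (\<Union>i. A i)"
    then obtain i y where "(x, y) \<in> F i" using F by force
    then have "(x, case_nat i y) \<in> ?G" by auto
    then show "x \<in> fst ` ?G" by (rule image_eqI[rotated]) simp
  next
    fix x assume "x \<in> fst ` ?G"
    then obtain y where "(x, y) \<in> ?G" by auto
    then have "x \<in> fst ` F (y 0)"
      by (intro image_eqI[where x = "(x, \<lambda>k. y (Suc k))"]) auto
    then show "x \<in> (\<Union>i. A i)" using F(2) by blast
  qed
  ultimately show ?thesis unfolding analytic_set_def by blast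
qed

text \<open>A single sequence carries witnesses for all \<open>A i\<close> at once: the one for
  \<open>A i\<close> sits at the positions \<open>prod_encode (i, k)\<close>.\<close>

lemma analytic_set_INT:
  assumes "\<And>i::nat. analytic_set (A i)"
  shows "analytic_set (\<Inter>i. A i)"
proof -
  obtain F where F: "\<And>i. closed (F i)" "\<And>i. A i = fst ` (F i :: ('a \<times> (nat \<Rightarrow> nat)) set)"
    using assms unfolding analytic_set_def by metis
  let ?G = "\<Inter>i. {p :: 'a \<times> (nat \<Rightarrow> nat). (fst p, \<lambda>k. snd p (prod_encode (i, k))) \<in> F i}"
  have "closed ?G"
    by (intro closed_INT ballI closed_vimage_continuous F
        continuous_on_Pair continuous_on_fst continuous_on_id continuous_on_coordinatewise_then_product
        continuous_on_apply)
  moreover have "(\<Inter>i. A i) = fst ` ?G"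
  proof (intro equalityI subsetI)
    fix x assume "x \<in> (\<Inter>i. A i)"
    then have "\<forall>i. \<exists>y. (x, y) \<in> F i" using F by force
    then obtain y where y: "\<And>i. (x, y i) \<in> F i" by metis
    have "(x, \<lambda>n. case_prod y (prod_decode n)) \<in> ?G" using y by auto
    then show "x \<in> fst ` ?G" by (rule image_eqI[rotated]) simp
  next
    fix x assume "x \<in> fst ` ?G"
    then obtain y where "(x, y) \<in> ?G" by auto
    then have "x \<in> fst ` F i" for i
      by (intro image_eqI[where x = "(x, \<lambda>k. y (prod_encode (i, k)))"]) auto
    then show "x \<in> (\<Inter>i. A i)" using F(2) by blast
  qed
  ultimately show ?thesis unfolding analytic_set_def by blast
qed

text \<open>Serves to show that open sets are analytic. The pieces consist of the points at distance
  at least \<open>1/(n+1)\<close> from \<open>C\<close>; an empty \<open>C\<close> is treated apart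
  because \<open>infdist\<close> to it is 0.\<close>

lemma Compl_closed_eq_UN_closed:
  fixes C :: "'a::metric_space set"
  assumes "closed C"
  obtains D :: "nat \<Rightarrow> 'a set" where "\<And>n. closed (D n)" "- C = (\<Union>n. D n)"
proof (cases "C = {}")
  case True
  then show ?thesis using that[of "\<lambda>_. UNIV"] by simp
next
  case False
  let ?D = "\<lambda>n. {x. inverse (real (Suc n)) \<le> infdist x C}"
  have "closed (?D n)" for n
    by (intro closed_Collect_le continuous_on_const continuous_on_infdist continuous_on_id)
  moreover have "- C = (\<Union>n. ?D n)"
  proof (intro equalityI subsetI)
    fix x assume "x \<in> - C"
    then have "0 < infdist x C"
      using assms False infdist_pos_not_in_closed[of C x] by simp
    then show "x \<in> (\<Union>n. ?D n)"
      using reals_Archimedean[of "infdist x C"] by (auto intro: less_imp_le)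
  next
    fix x assume "x \<in> (\<Union>n. ?D n)"
    then obtain n where "inverse (real (Suc n)) \<le> infdist x C" by auto
    moreover have "0 < inverse (real (Suc n))" by simp
    ultimately have "infdist x C \<noteq> 0" by linarith
    then show "x \<in> - C" by auto
  qed
  ultimately show ?thesis by (rule that)
qed

lemma analytic_set_borel:
  fixes A :: "'a::metric_space set"
  assumes "A \<in> sets borel"
  shows "analytic_set A"
proof -
  have "A \<in> sigma_sets UNIV (Collect closed)"
    using assms unfolding borel_eq_closed by simp
  \<comment> \<open>Complements of analytic sets need not be analytic, so the induction carries each
    set together with its complement.\<close>
  then have "analytic_set A \<and> analytic_set (- A)"
  proof induction
    case (Basic C)
    then obtain D :: "nat \<Rightarrow> 'a set" where "\<And>n. closed (D n)" "- C = (\<Union>n. D n)"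
      using Compl_closed_eq_UN_closed by auto
    then show ?case using Basic by (simp add: analytic_set_closed analytic_set_UN)
  next
    case Empty
    then show ?case by (simp add: analytic_set_closed)
  next
    case (Compl a)
    then show ?case by (simp add: Compl_eq_Diff_UNIV[symmetric])
  next
    case (Union a)
    then show ?case by (simp add: analytic_set_UN analytic_set_INT Compl_UN)
  qed
  then show ?thesis ..
qed

section \<open>Borel separation of disjoint images\<close>

definition borel_separated :: "'b::topological_space set \<Rightarrow> 'b set \<Rightarrow> bool" where
  "borel_separated P Q \<longleftrightarrow> (\<exists>B\<in>sets borel. P \<subseteq> B \<and> B \<inter> Q = {})"

text \<open>If \<open>B i j\<close> separates \<open>P i\<close> from \<open>Q j\<close>, the union
  over \<open>i\<close> of the intersections over \<open>j\<close> separates the unions.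
  Contrapositively, if two unions cannot be separated, then neither can some pair of their pieces;
  this is how \<open>Lusin_separation\<close> shrinks its sets.\<close>

lemma borel_separated_UN:
  assumes "countable I" "countable J" "\<And>i j. i \<in> I \<Longrightarrow> j \<in> J \<Longrightarrow> borel_separated (P i) (Q j)"
  shows "borel_separated (\<Union>i\<in>I. P i) (\<Union>j\<in>J. Q j)"
proof -
  have "\<forall>i\<in>I. \<forall>j\<in>J. \<exists>B. B \<in> sets borel \<and> P i \<subseteq> B \<and> B \<inter> Q j = {}"
  proof (intro ballI)
    fix i j assume "i \<in> I" "j \<in> J"
    from assms(3)[OF this] show "\<exists>B. B \<in> sets borel \<and> P i \<subseteq> B \<and> B \<inter> Q j = {}"
      by (auto simp: borel_separated_def)
  qed
  then obtain B where B: "\<And>i j. i \<in> I \<Longrightarrow> j \<in> J \<Longrightarrow> B i j \<in> sets borel \<and> P i \<subseteq> B i j \<and> B i j \<inter> Q j = {}"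
    by metis
  have "(\<Inter>j\<in>J. B i j) \<in> sets borel" if "i \<in> I" for i
    using B that assms(2) by (intro sets.countable_INT'') auto
  then have "(\<Union>i\<in>I. \<Inter>j\<in>J. B i j) \<in> sets borel"
    using assms(1) by (intro sets.countable_UN') auto
  moreover have "(\<Union>i\<in>I. P i) \<subseteq> (\<Union>i\<in>I. \<Inter>j\<in>J. B i j)"
    using B by blast
  moreover have "(\<Union>i\<in>I. \<Inter>j\<in>J. B i j) \<inter> (\<Union>j\<in>J. Q j) = {}"
    using B by blast
  ultimately show ?thesis unfolding borel_separated_def by blast
qed

lemma countable_closed_cover_small:
  fixes F :: "'a::{metric_space, second_countable_topology} set"
  assumes "closed F" "0 < e"
  obtains I :: "'a set" where "countable I" "F = (\<Union>c\<in>I. F \<inter> cball c e)"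
proof -
  obtain I :: "'a set" where I: "countable I" "\<And>U. open U \<Longrightarrow> U \<noteq> {} \<Longrightarrow> \<exists>d\<in>I. d \<in> U"
    using countable_dense_setE by blast
  have "\<exists>c\<in>I. x \<in> cball c e" for x
    using I(2)[of "ball x e"] assms(2) by (auto simp: dist_commute) force
  then show ?thesis using that[of I] I(1) by blast
qed

text \<open>
  If the images were not separated, cutting both sets into ever smaller pieces would produce two
  points with distinct images such that no neighbourhoods of them have separated images.
\<close>
lemma Lusin_separation:
  fixes f :: "'a::{complete_space, second_countable_topology} \<Rightarrow> 'b::t2_space"
  assumes F: "closed F" "closed G" and f: "continuous_on UNIV f" and disj: "f ` F \<inter> f ` G = {}"
  shows "borel_separated (f ` F) (f ` G)"
proof (rule ccontr)
  assume nsep: "\<not> borel_separated (f ` F) (f ` G)"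
  \<comment> \<open>An \<open>ok\<close> pair consists of closed sets whose images cannot be
    separated. Cutting both sets into countably many small closed pieces leaves some pair of pieces
    that is again \<open>ok\<close>.\<close>
  define ok where "ok = (\<lambda>(P, Q). closed P \<and> closed Q \<and> \<not> borel_separated (f ` P) (f ` Q))"
  define small where "small n P \<longleftrightarrow> (\<exists>c. P \<subseteq> cball c (inverse (real (Suc n))))" for n and P :: "'a set"
  have step: "\<exists>R'. ok R' \<and> fst R' \<subseteq> fst R \<and> snd R' \<subseteq> snd R \<and> small n (fst R') \<and> small n (snd R')"
    if R: "ok R" for R n
  proof (rule ccontr)
    assume no: "\<nexists>R'. ok R' \<and> fst R' \<subseteq> fst R \<and> snd R' \<subseteq> snd R \<and> small n (fst R') \<and> small n (snd R')"
    obtain P Q where PQ: "R = (P, Q)" by fastforce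
    then have cl: "closed P" "closed Q" and ns: "\<not> borel_separated (f ` P) (f ` Q)"
      using R by (auto simp: ok_def)
    let ?e = "inverse (real (Suc n))"
    obtain I where I: "countable I" "P = (\<Union>c\<in>I. P \<inter> cball c ?e)"
      using countable_closed_cover_small[OF cl(1), of ?e] by auto
    obtain J where J: "countable J" "Q = (\<Union>c\<in>J. Q \<inter> cball c ?e)"
      using countable_closed_cover_small[OF cl(2), of ?e] by auto
    have "borel_separated (f ` (P \<inter> cball c ?e)) (f ` (Q \<inter> cball c' ?e))" for c c'
      using no[unfolded not_ex, rule_format, of "(P \<inter> cball c ?e, Q \<inter> cball c' ?e)"] cl
      by (auto simp: ok_def PQ small_def closed_Int)
    then have "borel_separated (\<Union>c\<in>I. f ` (P \<inter> cball c ?e)) (\<Union>c\<in>J. f ` (Q \<inter> cball c ?e))"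
      using I(1) J(1) by (intro borel_separated_UN)
    then show False using ns I(2) J(2) by (metis image_UN)
  qed
  \<comment> \<open>The clause for \<open>n = 0\<close> anchors the chain at \<open>(F, G)\<close>,
    so that the limit points found below lie in \<open>F\<close> and in \<open>G\<close>.\<close>
  have "\<exists>R. \<forall>n::nat. (ok (R n) \<and> (n = 0 \<longrightarrow> R n = (F, G))) \<and>
      (fst (R (Suc n)) \<subseteq> fst (R n) \<and> snd (R (Suc n)) \<subseteq> snd (R n) \<and>
      small n (fst (R (Suc n))) \<and> small n (snd (R (Suc n))))"
  proof (rule dependent_nat_choice[of "\<lambda>n R. ok R \<and> (n = 0 \<longrightarrow> R = (F, G))"
        "\<lambda>n R R'. fst R' \<subseteq> fst R \<and> snd R' \<subseteq> snd R \<and> small n (fst R') \<and> small n (snd R')"])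
    show "\<exists>R. ok R \<and> ((0::nat) = 0 \<longrightarrow> R = (F, G))"
      using nsep F by (auto simp: ok_def)
  next
    fix R and n :: nat assume "ok R \<and> (n = 0 \<longrightarrow> R = (F, G))"
    then show "\<exists>R'. (ok R' \<and> (Suc n = 0 \<longrightarrow> R' = (F, G))) \<and>
        (fst R' \<subseteq> fst R \<and> snd R' \<subseteq> snd R \<and> small n (fst R') \<and> small n (snd R'))"
      using step[of R n] by blast
  qed
  then obtain R where R: "\<And>n. ok (R n) \<and> (n = 0 \<longrightarrow> R n = (F, G))"
    and RS: "\<And>n. fst (R (Suc n)) \<subseteq> fst (R n) \<and> snd (R (Suc n)) \<subseteq> snd (R n) \<and>
      small n (fst (R (Suc n))) \<and> small n (snd (R (Suc n)))"
    by blast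
  \<comment> \<open>Cantor's intersection theorem, with the addition that the sets eventually lie
    inside any given neighbourhood of the common point.\<close>
  have nest: "\<exists>a. (\<forall>n. a \<in> K n) \<and> (\<forall>U. open U \<longrightarrow> a \<in> U \<longrightarrow> (\<exists>n. K n \<subseteq> U))"
    if K: "\<And>n. closed (K n)" "\<And>n. K n \<noteq> {}" "\<And>n. K (Suc n) \<subseteq> K n" "\<And>n. small n (K (Suc n))"
    for K :: "nat \<Rightarrow> 'a set"
  proof -
    have mono: "K n \<subseteq> K m" if "m \<le> n" for m n
      using that K(3) by (rule lift_Suc_antimono_le[rotated])
    have small: "\<exists>n. \<forall>x\<in>K n. \<forall>y\<in>K n. dist x y < e" if "0 < e" for e
    proof -
      obtain n where n: "inverse (real (Suc n)) < e / 2"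
        using reals_Archimedean[of "e / 2"] \<open>0 < e\<close> half_gt_zero by blast
      obtain c where c: "K (Suc n) \<subseteq> cball c (inverse (real (Suc n)))"
        using K(4) by (auto simp: small_def)
      have "dist x y < e" if "x \<in> K (Suc n)" "y \<in> K (Suc n)" for x y
      proof -
        have "dist c x < e / 2" "dist c y < e / 2" using c that n by force+
        then show ?thesis using dist_triangle_half_r[of c x e y] by simp
      qed
      then show ?thesis by blast
    qed
    obtain a where a: "\<And>n. a \<in> K n"
      using decreasing_closed_nest[of K] K(1,2) mono small by blast
    have "\<exists>n. K n \<subseteq> U" if U: "open U" "a \<in> U" for U
    proof -
      obtain e where "0 < e" "ball a e \<subseteq> U" using U by (auto simp: open_contains_ball)
      moreover obtain n where "\<forall>x\<in>K n. \<forall>y\<in>K n. dist x y < e" using small[OF \<open>0 < e\<close>] by blast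
      ultimately show ?thesis using a by (intro exI[of _ n]) (auto simp: subset_iff)
    qed
    then show ?thesis using a by blast
  qed
  \<comment> \<open>An empty image is separated from any other by the empty set or by the whole
    space, so no set in the chain is empty.\<close>
  have ne: "fst (R n) \<noteq> {}" "snd (R n) \<noteq> {}" for n
  proof -
    have "\<not> borel_separated (f ` fst (R n)) (f ` snd (R n))" using R[of n] by (auto simp: ok_def split: prod.splits)
    then show "fst (R n) \<noteq> {}" "snd (R n) \<noteq> {}"
      by (auto simp: borel_separated_def)
  qed
  have cl: "closed (fst (R n))" "closed (snd (R n))" for n
    using R[of n] by (auto simp: ok_def split: prod.splits)
  obtain a where a: "\<And>n. a \<in> fst (R n)" "\<And>U. open U \<Longrightarrow> a \<in> U \<Longrightarrow> \<exists>n. fst (R n) \<subseteq> U"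
    using nest[of "\<lambda>n. fst (R n)"] cl ne RS by auto
  obtain b where b: "\<And>n. b \<in> snd (R n)" "\<And>U. open U \<Longrightarrow> b \<in> U \<Longrightarrow> \<exists>n. snd (R n) \<subseteq> U"
    using nest[of "\<lambda>n. snd (R n)"] cl ne RS by auto
  have "a \<in> F" "b \<in> G" using a(1)[of 0] b(1)[of 0] R[of 0] by auto
  then have "f a \<noteq> f b" using disj by auto
  then obtain U V where UV: "open U" "open V" "f a \<in> U" "f b \<in> V" "U \<inter> V = {}"
    using hausdorff by metis
  have op: "open (f -` U)" "open (f -` V)"
    using UV f by (auto intro: open_vimage)
  obtain m n where m: "fst (R m) \<subseteq> f -` U" and n: "snd (R n) \<subseteq> f -` V"
    using a(2)[OF op(1)] b(2)[OF op(2)] UV by auto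
  \<comment> \<open>From stage \<open>?k\<close> on, the open set \<open>U\<close> itself separates
    the two images, contrary to the choice of the chain.\<close>
  let ?k = "max m n"
  have "fst (R ?k) \<subseteq> fst (R m)" "snd (R ?k) \<subseteq> snd (R n)"
    using RS lift_Suc_antimono_le[of "\<lambda>n. fst (R n)" m ?k] lift_Suc_antimono_le[of "\<lambda>n. snd (R n)" n ?k]
    by auto
  then have "f ` fst (R ?k) \<subseteq> U" "U \<inter> f ` snd (R ?k) = {}"
    using m n UV(5) by auto
  then have "borel_separated (f ` fst (R ?k)) (f ` snd (R ?k))"
    using UV(1) unfolding borel_separated_def by (intro bexI[of _ U]) auto
  moreover have "\<not> borel_separated (f ` fst (R ?k)) (f ` snd (R ?k))"
    using R[of ?k] by (auto simp: ok_def split: prod.splits)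
  ultimately show False by simp
qed

lemma borel_image_separation:
  fixes f :: "'a::polish_space \<Rightarrow> 'b::polish_space"
  assumes P: "P \<in> sets borel" and Q: "Q \<in> sets borel" and f: "f \<in> borel \<rightarrow>\<^sub>M borel"
    and disj: "f ` P \<inter> f ` Q = {}"
  shows "borel_separated (f ` P) (f ` Q)"
proof -
  have graph: "\<exists>K :: (('a \<times> 'b) \<times> (nat \<Rightarrow> nat)) set. closed K \<and> f ` C = (snd \<circ> fst) ` K"
    if C: "C \<in> sets borel" for C
  proof -
    have "{p :: 'a \<times> 'b. f (fst p) = snd p} \<in> sets borel"
    proof -
      have fst: "fst \<in> (borel :: ('a \<times> 'b) measure) \<rightarrow>\<^sub>M borel"
        and snd: "snd \<in> (borel :: ('a \<times> 'b) measure) \<rightarrow>\<^sub>M borel"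
        by (intro borel_measurable_continuous_onI continuous_intros)+
      have "(\<lambda>p :: 'a \<times> 'b. dist (f (fst p)) (snd p)) \<in> borel \<rightarrow>\<^sub>M borel"
        by (intro borel_measurable_dist measurable_compose[OF fst f] snd)
      then have "{p \<in> space borel. dist (f (fst p)) (snd p) = 0} \<in> sets (borel :: ('a \<times> 'b) measure)"
        by measurable
      then show ?thesis by simp
    qed
    moreover have "{p :: 'a \<times> 'b. fst p \<in> C} \<in> sets borel"
      using measurable_sets_borel[OF borel_measurable_continuous_onI[OF continuous_on_fst[OF continuous_on_id]] C]
      by (simp add: vimage_def)
    ultimately have "{p :: 'a \<times> 'b. fst p \<in> C} \<inter> {p. f (fst p) = snd p} \<in> sets borel"
      by (rule sets.Int[rotated])
    then have "analytic_set ({p :: 'a \<times> 'b. fst p \<in> C} \<inter> {p. f (fst p) = snd p})"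
      by (rule analytic_set_borel)
    moreover have "f ` C = snd ` ({p :: 'a \<times> 'b. fst p \<in> C} \<inter> {p. f (fst p) = snd p})"
      by (auto intro!: image_eqI[where x = "(_, f _)"])
    ultimately show ?thesis unfolding analytic_set_def by (metis image_comp)
  qed
  obtain K L :: "(('a \<times> 'b) \<times> (nat \<Rightarrow> nat)) set" where K: "closed K" "f ` P = (snd \<circ> fst) ` K"
    and L: "closed L" "f ` Q = (snd \<circ> fst) ` L"
    using graph[OF P] graph[OF Q] by blast
  have "continuous_on UNIV (snd \<circ> fst :: ('a \<times> 'b) \<times> (nat \<Rightarrow> nat) \<Rightarrow> 'b)"
    unfolding comp_def by (intro continuous_intros)
  then show ?thesis using Lusin_separation[OF K(1) L(1)] K(2) L(2) disj by simp
qed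

subsection \<open>Blackwell spaces\<close>

text \<open>Coordinate \<open>n\<close> alone gives a neighbourhood that suffices for continuity in
  \<open>Polish_topology_parametrization\<close>: there the \<open>n\<close>-th centre lies within
  \<open>2 * (1/2) ^ n\<close> of the limit.\<close>

lemma openin_agree_upto:
  "openin (top_of_set D) {\<tau> \<in> D. \<tau> n = (\<sigma> :: nat \<Rightarrow> nat) n}"
proof -
  have "open {\<tau> :: nat \<Rightarrow> nat. \<tau> n = \<sigma> n}"
    using open_vimage[OF discrete_topology_class.open_discrete[of "{\<sigma> n}"] continuous_on_product_coordinates[of n]]
    by (simp add: vimage_def)
  then show ?thesis by (auto simp: openin_open)
qed

text \<open>
  A point is coded by a sequence of indices of dense points that converges to it fast.
\<close>
lemma Polish_topology_parametrization:
  fixes Z :: "'z topology"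
  assumes "Polish_topology Z"
  obtains D :: "(nat \<Rightarrow> nat) set" and \<phi> where
    "closed D" "continuous_map (top_of_set D) Z \<phi>" "\<phi> ` D = topspace Z"
proof (cases "topspace Z = {}")
  case True
  then show ?thesis using that[of "{}" undefined] by (simp add: continuous_map_def)
next
  case False
  obtain M d where "Metric_space M d" "Metric_space.mcomplete M d" and Z: "Z = Metric_space.mtopology M d"
    using assms by (auto simp: Polish_topology_def completely_metrizable_space_def)
  then interpret Metric_space M d by simp
  obtain C where C: "countable C" "C \<subseteq> M" "mtopology closure_of C = M"
    using assms Z by (auto simp: Polish_topology_def separable_space_def)
  then have "C \<noteq> {}" using False Z by auto
  define c where "c = from_nat_into C"
  have cM [simp]: "c i \<in> M" for i
    using from_nat_into[OF \<open>C \<noteq> {}\<close>] C(2) by (auto simp: c_def)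
  have dense: "\<exists>i. d (c i) x < e" if "x \<in> M" "0 < e" for x e
  proof -
    have "x \<in> mtopology closure_of C" using C that by simp
    then obtain a where "a \<in> C" "a \<in> mball x e"
      using \<open>0 < e\<close> by (auto simp: metric_closure_of)
    then show ?thesis
      using from_nat_into_surj[OF C(1)] by (metis c_def commute in_mball)
  qed
  \<comment> \<open>The steps are summable, so the coded sequences are Cauchy; each single condition
    involves only two coordinates, which makes \<open>D\<close> closed.\<close>
  define D where "D = {\<sigma>. \<forall>n. d (c (\<sigma> n)) (c (\<sigma> (Suc n))) \<le> (1/2) ^ n}"
  define \<phi> where "\<phi> \<sigma> = (SOME l. limitin mtopology (\<lambda>n. c (\<sigma> n)) l sequentially)" for \<sigma>
  have "closed D"
  proof -
    have "open {\<sigma> :: nat \<Rightarrow> nat. \<sigma> n = i \<and> \<sigma> (Suc n) = j}" for n i j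
    proof -
      have "open {\<sigma> :: nat \<Rightarrow> nat. \<sigma> m = k}" for m k
        using openin_agree_upto[of UNIV m "\<lambda>_. k"] by simp
      then show ?thesis by (simp add: open_Collect_conj)
    qed
    then have "open (\<Union>n. \<Union>(i, j)\<in>{(i, j). \<not> d (c i) (c j) \<le> (1/2) ^ n}. {\<sigma>. \<sigma> n = i \<and> \<sigma> (Suc n) = j})"
      by (intro open_UN) auto
    moreover have "- D = (\<Union>n. \<Union>(i, j)\<in>{(i, j). \<not> d (c i) (c j) \<le> (1/2) ^ n}. {\<sigma>. \<sigma> n = i \<and> \<sigma> (Suc n) = j})"
      by (auto simp: D_def)
    ultimately show ?thesis by (simp add: closed_def)
  qed
  \<comment> \<open>The partial geometric sum is kept in closed form because the bound
    \<open>2 * (1/2) ^ n\<close> alone would not pass through the induction.\<close>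
  have near: "d (c (\<sigma> n)) (c (\<sigma> (n + k))) \<le> 2 * (1/2) ^ n - 2 * (1/2) ^ (n + k)" if "\<sigma> \<in> D" for \<sigma> n k
  proof (induction k)
    case (Suc k)
    have "d (c (\<sigma> (n + k))) (c (\<sigma> (Suc (n + k)))) \<le> (1/2) ^ (n + k)"
      using that by (auto simp: D_def)
    moreover have "d (c (\<sigma> n)) (c (\<sigma> (Suc (n + k)))) \<le>
        d (c (\<sigma> n)) (c (\<sigma> (n + k))) + d (c (\<sigma> (n + k))) (c (\<sigma> (Suc (n + k))))"
      by (intro triangle) auto
    ultimately show ?case using Suc by (simp only: add_Suc_right power_Suc)
  qed simp
  have near': "d (c (\<sigma> n)) (c (\<sigma> m)) \<le> 2 * (1/2) ^ n" if "\<sigma> \<in> D" "n \<le> m" for \<sigma> n m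
  proof -
    have "d (c (\<sigma> n)) (c (\<sigma> m)) \<le> 2 * (1/2) ^ n - 2 * (1/2) ^ m"
      using near[OF that(1), of n "m - n"] that(2) by simp
    moreover have "0 \<le> (1/2 :: real) ^ m" by simp
    ultimately show ?thesis by linarith
  qed
  have lim: "limitin mtopology (\<lambda>n. c (\<sigma> n)) (\<phi> \<sigma>) sequentially" if \<sigma>: "\<sigma> \<in> D" for \<sigma>
  proof -
    have "MCauchy (\<lambda>n. c (\<sigma> n))"
      unfolding MCauchy_def
    proof (intro conjI allI impI)
      fix e :: real assume "0 < e"
      then obtain N where N: "(1/2 :: real) ^ N < e / 4"
        using real_arch_pow_inv[of "e / 4" "1/2"] by auto
      have "d (c (\<sigma> n)) (c (\<sigma> n')) < e" if "N \<le> n" "N \<le> n'" for n n'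
      proof -
        have "d (c (\<sigma> n)) (c (\<sigma> n')) \<le> d (c (\<sigma> n)) (c (\<sigma> N)) + d (c (\<sigma> N)) (c (\<sigma> n'))"
          by (intro triangle) auto
        then show ?thesis
          using near'[OF \<sigma> that(1)] near'[OF \<sigma> that(2)] N commute[of "c (\<sigma> n)" "c (\<sigma> N)"] by linarith
      qed
      then show "\<exists>N. \<forall>n n'. N \<le> n \<longrightarrow> N \<le> n' \<longrightarrow> d (c (\<sigma> n)) (c (\<sigma> n')) < e" by blast
    qed auto
    then have "\<exists>l. limitin mtopology (\<lambda>n. c (\<sigma> n)) l sequentially"
      using \<open>mcomplete\<close> unfolding mcomplete_def by blast
    then show ?thesis unfolding \<phi>_def by (rule someI_ex)
  qed
  then have \<phi>M: "\<phi> \<sigma> \<in> M" if "\<sigma> \<in> D" for \<sigma>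
    using limitin_mspace that by blast
  have near_lim: "d (c (\<sigma> n)) (\<phi> \<sigma>) \<le> 2 * (1/2) ^ n" if \<sigma>: "\<sigma> \<in> D" for \<sigma> n
  proof (rule field_le_epsilon)
    fix e :: real assume "0 < e"
    then obtain N where "\<And>m. N \<le> m \<Longrightarrow> d (c (\<sigma> m)) (\<phi> \<sigma>) < e"
      using lim[OF \<sigma>] unfolding limit_metric_sequentially by blast
    then have "d (c (\<sigma> (max N n))) (\<phi> \<sigma>) < e" by simp
    moreover have "d (c (\<sigma> n)) (c (\<sigma> (max N n))) \<le> 2 * (1/2) ^ n"
      by (intro near' \<sigma>) simp
    moreover have "d (c (\<sigma> n)) (\<phi> \<sigma>) \<le> d (c (\<sigma> n)) (c (\<sigma> (max N n))) + d (c (\<sigma> (max N n))) (\<phi> \<sigma>)"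
      by (intro triangle \<phi>M \<sigma>) auto
    ultimately show "d (c (\<sigma> n)) (\<phi> \<sigma>) \<le> 2 * (1/2) ^ n + e" by linarith
  qed
  have "continuous_map (top_of_set D) Z \<phi>"
    unfolding Z continuous_map_to_metric
  proof (intro ballI allI impI)
    fix \<sigma> and e :: real assume "\<sigma> \<in> topspace (top_of_set D)" "0 < e"
    then have \<sigma>: "\<sigma> \<in> D" by simp
    obtain n where n: "(1/2 :: real) ^ n < e / 4"
      using real_arch_pow_inv[of "e / 4" "1/2"] \<open>0 < e\<close> by auto
    have "\<phi> \<tau> \<in> mball (\<phi> \<sigma>) e" if "\<tau> \<in> D" "\<tau> n = \<sigma> n" for \<tau>
    proof -
      have "d (\<phi> \<sigma>) (\<phi> \<tau>) \<le> d (\<phi> \<sigma>) (c (\<sigma> n)) + d (c (\<sigma> n)) (\<phi> \<tau>)"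
        by (intro triangle \<phi>M \<sigma> that) auto
      then show ?thesis
        using near_lim[OF \<sigma>, of n] near_lim[OF that(1), of n] n commute[of "\<phi> \<sigma>" "c (\<sigma> n)"] \<phi>M \<sigma> that
        by auto
    qed
    then show "\<exists>U. openin (top_of_set D) U \<and> \<sigma> \<in> U \<and> (\<forall>y\<in>U. \<phi> y \<in> mball (\<phi> \<sigma>) e)"
      using \<sigma> openin_agree_upto[of D n \<sigma>] by blast
  qed
  moreover have "\<phi> ` D = topspace Z"
  proof (intro equalityI subsetI)
    fix x assume "x \<in> topspace Z"
    then have x: "x \<in> M" using Z by simp
    \<comment> \<open>The additional factor 1/2 leaves room for the triangle inequality: consecutive
      centres are then within \<open>(1/2) ^ n\<close> of each other, as \<open>D\<close>
      demands.\<close>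
    have "\<exists>i. d (c i) x < (1/2) ^ n / 2" for n
      by (intro dense x) simp
    then obtain \<sigma> where \<sigma>: "\<And>n. d (c (\<sigma> n)) x < (1/2) ^ n / 2" by metis
    have D: "\<sigma> \<in> D"
      unfolding D_def
    proof (intro CollectI allI)
      fix n
      have "d (c (\<sigma> n)) (c (\<sigma> (Suc n))) \<le> d (c (\<sigma> n)) x + d x (c (\<sigma> (Suc n)))"
        by (intro triangle x) auto
      moreover have "d x (c (\<sigma> (Suc n))) < (1/2) ^ n / 2"
      proof -
        have "(1/2 :: real) ^ Suc n = (1/2) ^ n / 2" "0 < (1/2 :: real) ^ n" by simp_all
        then show ?thesis using \<sigma>[of "Suc n"] commute[of x "c (\<sigma> (Suc n))"] by linarith
      qed
      ultimately show "d (c (\<sigma> n)) (c (\<sigma> (Suc n))) \<le> (1/2) ^ n"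
        using \<sigma>[of n] by simp
    qed
    have "limitin mtopology (\<lambda>n. c (\<sigma> n)) x sequentially"
      unfolding limit_metric_sequentially
    proof (intro conjI allI impI x)
      fix e :: real assume "0 < e"
      then obtain N where N: "(1/2 :: real) ^ N < e"
        using real_arch_pow_inv[of e "1/2"] by auto
      have "d (c (\<sigma> n)) x < e" if "N \<le> n" for n
      proof -
        have "(1/2 :: real) ^ n \<le> (1/2) ^ N" by (rule power_decreasing[OF that]) auto
        moreover have "0 < (1/2 :: real) ^ n" by simp
        ultimately show ?thesis using \<sigma>[of n] N by linarith
      qed
      then show "\<exists>N. \<forall>n\<ge>N. c (\<sigma> n) \<in> M \<and> d (c (\<sigma> n)) x < e" by auto
    qed
    then have "x = \<phi> \<sigma>"
      using limitin_metric_unique[OF _ lim[OF D]] by simp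
    then show "x \<in> \<phi> ` D" using D by blast
  qed (use \<phi>M Z in auto)
  ultimately show ?thesis using that \<open>closed D\<close> by blast
qed

text \<open>Measurable sets are unions of atoms, which lets them be carried to the Hausdorff
  quotient and back without loss.\<close>

lemma mem_atom_relD:
  assumes "atom_rel M `` {x} = atom_rel M `` {y}" "x \<in> space M" "y \<in> space M" "A \<in> sets M"
  shows "x \<in> A \<longleftrightarrow> y \<in> A"
proof -
  have "(y, y) \<in> atom_rel M" using assms by (simp add: atom_rel_def)
  then have "(x, y) \<in> atom_rel M" using assms(1) by blast
  then have "indicator A x = (indicator A y :: real)" using assms(4) by (simp add: atom_rel_def)
  then show ?thesis by (auto simp: indicator_def split: if_splits)
qed

text \<open>
  The sets \<open>A\<close> and \<open>space M - A\<close>, pulled back to a closed set of sequences, have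
  disjoint images under the indicator sequence of the generators of the sub-\<open>\<sigma>\<close>-field; a Borel set
  that separates these images exhibits \<open>A\<close> as a member.
\<close>
theorem Blackwell_sigma_sets:
  assumes M: "Blackwell_measurable M" and C: "countable C" "C \<subseteq> sets M" and A: "A \<in> sets M"
    and sat: "\<And>x y. x \<in> space M \<Longrightarrow> y \<in> space M \<Longrightarrow> (\<And>c. c \<in> C \<Longrightarrow> x \<in> c \<longleftrightarrow> y \<in> c) \<Longrightarrow> x \<in> A \<longleftrightarrow> y \<in> A"
  shows "A \<in> sigma_sets (space M) C"
proof -
  obtain Y :: "'a set topology" where Y: "Souslin_topology Y"
      "measurable_isomorphic (Hausdorff_quotient M) (borel_of Y)"
    using M unfolding Blackwell_measurable_def by blast
  obtain f g where g: "g \<in> borel_of Y \<rightarrow>\<^sub>M Hausdorff_quotient M"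
    and f: "f \<in> Hausdorff_quotient M \<rightarrow>\<^sub>M borel_of Y" "\<And>a. a \<in> atoms M \<Longrightarrow> g (f a) = a"
    using Y(2) unfolding measurable_isomorphic_def space_Hausdorff_quotient by metis
  obtain Z :: "real topology" and p where Z: "Polish_topology Z" and p: "continuous_map Z Y p"
      "p ` topspace Z = topspace Y"
    using Y(1) unfolding Souslin_topology_def by blast
  obtain D :: "(nat \<Rightarrow> nat) set" and \<phi> where D: "closed D"
    and \<phi>: "continuous_map (top_of_set D) Z \<phi>" "\<phi> ` D = topspace Z"
    using Polish_topology_parametrization[OF Z] by blast
  \<comment> \<open>The composite of \<open>D\<close>, \<open>Z\<close>, \<open>Y\<close> and the
    quotient parametrizes the atoms of \<open>M\<close> measurably by a closed subset of Baire
    space.\<close>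
  define \<psi> where "\<psi> = g \<circ> (p \<circ> \<phi>)"
  have \<psi>: "\<psi> \<in> restrict_space borel D \<rightarrow>\<^sub>M Hausdorff_quotient M"
  proof -
    have cont: "continuous_map (top_of_set D) Y (p \<circ> \<phi>)"
      by (rule continuous_map_compose[OF \<phi>(1) p(1)])
    have "(p \<circ> \<phi>) \<in> restrict_space borel D \<rightarrow>\<^sub>M borel_of Y"
      unfolding borel_of_def
    proof (rule measurable_measure_of)
      show "{U. openin Y U} \<subseteq> Pow (topspace Y)" using openin_subset by blast
      show "p \<circ> \<phi> \<in> space (restrict_space borel D) \<rightarrow> topspace Y"
        using cont by (auto simp: continuous_map_def space_restrict_space)
      fix U assume "U \<in> {U. openin Y U}"
      then have "openin (top_of_set D) {x \<in> D. (p \<circ> \<phi>) x \<in> U}"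
        using cont by (simp add: continuous_map_def)
      then obtain V where "open V" "{x \<in> D. (p \<circ> \<phi>) x \<in> U} = D \<inter> V"
        by (auto simp: openin_open)
      moreover have "(p \<circ> \<phi>) -` U \<inter> space (restrict_space borel D) = {x \<in> D. (p \<circ> \<phi>) x \<in> U}"
        by (auto simp: space_restrict_space)
      ultimately show "(p \<circ> \<phi>) -` U \<inter> space (restrict_space borel D) \<in> sets (restrict_space borel D)"
        by (auto simp: sets_restrict_space)
    qed
    then show ?thesis unfolding \<psi>_def using g by (rule measurable_comp)
  qed
  have surj: "\<exists>\<sigma>\<in>D. \<psi> \<sigma> = atom_rel M `` {x}" if "x \<in> space M" for x
  proof -
    have a: "atom_rel M `` {x} \<in> atoms M" using that by (auto simp: atoms_def intro: quotientI)
    then have "f (atom_rel M `` {x}) \<in> topspace Y"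
      using measurable_space[OF f(1)] by (simp add: space_Hausdorff_quotient space_borel_of)
    then obtain \<sigma> where "\<sigma> \<in> D" "p (\<phi> \<sigma>) = f (atom_rel M `` {x})"
      using p(2) \<phi>(2) by (metis imageE)
    then show ?thesis using f(2)[OF a] by (intro bexI[of _ \<sigma>]) (simp_all add: \<psi>_def)
  qed
  have atom: "\<exists>x\<in>space M. \<psi> \<sigma> = atom_rel M `` {x}" if "\<sigma> \<in> D" for \<sigma>
    using measurable_space[OF \<psi>] that
    by (auto simp: space_restrict_space space_Hausdorff_quotient atoms_def quotient_def)
  \<comment> \<open>For measurable \<open>B\<close> this is the preimage under \<open>\<psi>\<close>
    of the set of atoms contained in \<open>B\<close>.\<close>
  define pull where "pull B = {\<sigma> \<in> D. \<exists>x\<in>B. \<psi> \<sigma> = atom_rel M `` {x}}" for B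
  have mem_pull: "\<sigma> \<in> pull B \<longleftrightarrow> x \<in> B"
    if "B \<in> sets M" "\<sigma> \<in> D" "x \<in> space M" "\<psi> \<sigma> = atom_rel M `` {x}" for B \<sigma> x
  proof
    assume "\<sigma> \<in> pull B"
    then obtain y where y: "y \<in> B" "\<psi> \<sigma> = atom_rel M `` {y}" by (auto simp: pull_def)
    then have "y \<in> space M" using sets.sets_into_space[OF that(1)] by blast
    then show "x \<in> B" using mem_atom_relD[of M x y B] y that by simp
  qed (use that in \<open>auto simp: pull_def\<close>)
  have pull_borel: "pull B \<in> sets borel" if B: "B \<in> sets M" for B
  proof -
    have "{x \<in> space M. atom_rel M `` {x} \<in> (\<lambda>x. atom_rel M `` {x}) ` B} = B"
    proof (intro equalityI subsetI)
      fix x assume "x \<in> {x \<in> space M. atom_rel M `` {x} \<in> (\<lambda>x. atom_rel M `` {x}) ` B}"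
      then obtain y where y: "x \<in> space M" "y \<in> B" "atom_rel M `` {x} = atom_rel M `` {y}" by blast
      then have "y \<in> space M" using sets.sets_into_space[OF B] by blast
      then show "x \<in> B" using mem_atom_relD[OF y(3,1) _ B] y(2) by simp
    qed (use sets.sets_into_space[OF B] in auto)
    then have "(\<lambda>x. atom_rel M `` {x}) ` B \<in> sets (Hausdorff_quotient M)"
      using B sets.sets_into_space[OF B]
      by (auto simp: sets_Hausdorff_quotient atoms_def intro: quotientI)
    from measurable_sets[OF \<psi> this]
    have "\<psi> -` (\<lambda>x. atom_rel M `` {x}) ` B \<inter> D \<in> sets (restrict_space borel D)"
      by (simp add: space_restrict_space)
    moreover have "\<psi> -` (\<lambda>x. atom_rel M `` {x}) ` B \<inter> D = pull B"
      by (auto simp: pull_def)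
    ultimately show ?thesis
      using D by (simp add: sets_restrict_space_iff)
  qed
  \<comment> \<open>The empty set is inserted so that an enumeration exists even when
    \<open>C\<close> is empty; it adds nothing to the generated sigma-field.\<close>
  define c where "c = from_nat_into (insert {} C)"
  have c: "range c = insert {} C"
    unfolding c_def using C(1) by (intro range_from_nat_into) auto
  then have cM: "c n \<in> sets M" for n
    using C(2) by (metis insert_subset rangeI sets.empty_sets subsetD)
  \<comment> \<open>\<open>F\<close> is the indicator sequence of the pulled-back generators and
    \<open>h\<close> that of the generators themselves. They agree along \<open>\<psi>\<close>, so
    separation obtained in Baire space can be transferred back by \<open>h\<close>.\<close>
  define F where "F \<sigma> n = (if \<sigma> \<in> pull (c n) then 1 else 0 :: nat)" for \<sigma> n
  define h where "h x n = (if x \<in> c n then 1 else 0 :: nat)" for x n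
  have Fh: "F \<sigma> = h x" if "\<sigma> \<in> D" "x \<in> space M" "\<psi> \<sigma> = atom_rel M `` {x}" for \<sigma> x
    using mem_pull[OF cM that] by (auto simp: F_def h_def)
  have "F \<in> borel \<rightarrow>\<^sub>M borel"
  proof (rule measurable_coordinatewise_then_product)
    fix n
    show "(\<lambda>\<sigma>. F \<sigma> n) \<in> borel \<rightarrow>\<^sub>M borel"
      unfolding F_def by (rule measurable_If_set) (use pull_borel[OF cM] in auto)
  qed
  moreover have "F ` pull A \<inter> F ` (D - pull A) = {}"
  proof (rule ccontr)
    assume "F ` pull A \<inter> F ` (D - pull A) \<noteq> {}"
    then obtain \<sigma> \<tau> where st: "\<sigma> \<in> pull A" "\<tau> \<in> D" "\<tau> \<notin> pull A" "F \<sigma> = F \<tau>" by auto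
    then have "\<sigma> \<in> D" by (simp add: pull_def)
    obtain x y where x: "x \<in> space M" "\<psi> \<sigma> = atom_rel M `` {x}"
      and y: "y \<in> space M" "\<psi> \<tau> = atom_rel M `` {y}"
      using atom[OF \<open>\<sigma> \<in> D\<close>] atom[OF \<open>\<tau> \<in> D\<close>] by blast
    have "h x = h y" using Fh x y st \<open>\<sigma> \<in> D\<close> by metis
    then have "x \<in> c n \<longleftrightarrow> y \<in> c n" for n
      by (metis h_def zero_neq_one)
    then have "x \<in> A \<longleftrightarrow> y \<in> A"
      using c by (intro sat x y) (metis insertCI rangeE)
    then show False
      using mem_pull[OF A \<open>\<sigma> \<in> D\<close> x] mem_pull[OF A \<open>\<tau> \<in> D\<close> y] st by blast
  qed
  ultimately have "borel_separated (F ` pull A) (F ` (D - pull A))"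
    using pull_borel[OF A] D by (intro borel_image_separation) auto
  then obtain B where B: "B \<in> sets borel" "F ` pull A \<subseteq> B" "B \<inter> F ` (D - pull A) = {}"
    by (auto simp: borel_separated_def)
  \<comment> \<open>Each coordinate of \<open>h\<close> is the indicator of a generator, so the
    preimage of the separating set \<open>B\<close> under \<open>h\<close> lies in the generated
    sigma-field; this preimage will be \<open>A\<close>.\<close>
  let ?H = "sigma (space M) C"
  have CP: "C \<subseteq> Pow (space M)" using C(2) sets.sets_into_space by blast
  have "h \<in> ?H \<rightarrow>\<^sub>M borel"
  proof (rule measurable_coordinatewise_then_product)
    fix n
    have "c n \<in> sigma_sets (space M) C"
      using c by (metis insertE rangeI sigma_sets.Basic sigma_sets.Empty)
    then have "{x \<in> space ?H. x \<in> c n} \<in> sets ?H"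
      using CP sets.sets_into_space[OF cM] by (simp add: space_measure_of_conv Collect_conj_eq Int_absorb1)
    then show "(\<lambda>x. h x n) \<in> ?H \<rightarrow>\<^sub>M borel"
      unfolding h_def by (intro measurable_If measurable_const) auto
  qed
  then have "h -` B \<inter> space M \<in> sigma_sets (space M) C"
    using measurable_sets[OF _ B(1)] CP by (metis sets_measure_of space_measure_of)
  moreover have "h -` B \<inter> space M = A"
  proof -
    have "h x \<in> B \<longleftrightarrow> x \<in> A" if x: "x \<in> space M" for x
    proof -
      obtain \<sigma> where \<sigma>: "\<sigma> \<in> D" "\<psi> \<sigma> = atom_rel M `` {x}" using surj[OF x] by blast
      have "F \<sigma> \<in> B \<longleftrightarrow> \<sigma> \<in> pull A"
      proof
        assume "F \<sigma> \<in> B"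
        then have "F \<sigma> \<notin> F ` (D - pull A)" using B(3) by blast
        then show "\<sigma> \<in> pull A" using \<sigma>(1) by blast
      qed (use B(2) in blast)
      then have "h x \<in> B \<longleftrightarrow> \<sigma> \<in> pull A" unfolding Fh[OF \<sigma>(1) x \<sigma>(2)] .
      then show ?thesis using mem_pull[OF A \<sigma>(1) x \<sigma>(2)] by simp
    qed
    then show ?thesis using sets.sets_into_space[OF A] by blast
  qed
  ultimately show ?thesis by simp
qed

subsection \<open>Stopped processes\<close>

lemma sigma_sets_mem_iff:
  assumes "A \<in> sigma_sets \<Omega> C" "\<And>c. c \<in> C \<Longrightarrow> x \<in> c \<longleftrightarrow> y \<in> c" "x \<in> \<Omega>" "y \<in> \<Omega>"
  shows "x \<in> A \<longleftrightarrow> y \<in> A"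
  using assms(1) by induction (use assms(2-4) in auto)

text \<open>A common form for the fields of the natural filtration, with \<open>I\<close> the times
  of \<open>T\<close> up to \<open>t\<close>, and for their join, with \<open>I = T\<close>.\<close>

definition coord_sigma ::
  "'w set \<Rightarrow> real set \<Rightarrow> 'e measure \<Rightarrow> (real \<Rightarrow> 'w \<Rightarrow> 'e) \<Rightarrow> 'w measure" where
  "coord_sigma \<Omega> I E X = sigma \<Omega> {X s -` B \<inter> \<Omega> | s B. s \<in> I \<and> B \<in> sets E}"

lemma space_coord_sigma [simp]: "space (coord_sigma \<Omega> I E X) = \<Omega>"
  by (simp add: coord_sigma_def space_measure_of_conv)

lemma sets_coord_sigma:
  "sets (coord_sigma \<Omega> I E X) = sigma_sets \<Omega> {X s -` B \<inter> \<Omega> | s B. s \<in> I \<and> B \<in> sets E}"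
  unfolding coord_sigma_def by (rule sets_measure_of) auto

lemma coord_sigma_basic:
  "s \<in> I \<Longrightarrow> B \<in> sets E \<Longrightarrow> X s -` B \<inter> \<Omega> \<in> sets (coord_sigma \<Omega> I E X)"
  unfolding sets_coord_sigma by (rule sigma_sets.Basic) blast

lemma coord_sigma_mono: "I \<subseteq> J \<Longrightarrow> sets (coord_sigma \<Omega> I E X) \<subseteq> sets (coord_sigma \<Omega> J E X)"
  unfolding sets_coord_sigma by (rule sigma_sets_mono') blast

lemma coord_sigma_mem_iff:
  assumes "A \<in> sets (coord_sigma \<Omega> I E X)" "\<omega> \<in> \<Omega>" "\<omega>' \<in> \<Omega>" "\<And>s. s \<in> I \<Longrightarrow> X s \<omega> = X s \<omega>'"
  shows "\<omega> \<in> A \<longleftrightarrow> \<omega>' \<in> A"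
  using assms(1) unfolding sets_coord_sigma
  by (rule sigma_sets_mem_iff) (use assms(2-4) in auto)

text \<open>Complements are taken relative to \<open>R\<close>, which itself belongs to
  \<open>N\<close>; hence it is enough to check traces of generators. This is applied to events on
  which the process has not yet been stopped.\<close>

lemma coord_sigma_Int:
  assumes A: "A \<in> sets (coord_sigma \<Omega> I E X)" and R: "R \<in> sets N" "R \<subseteq> \<Omega>"
    and gen: "\<And>s B. s \<in> I \<Longrightarrow> B \<in> sets E \<Longrightarrow> (X s -` B \<inter> \<Omega>) \<inter> R \<in> sets N"
  shows "A \<inter> R \<in> sets N"
  using A unfolding sets_coord_sigma
proof induction
  case (Compl a)
  have "(\<Omega> - a) \<inter> R = R - a \<inter> R" using R(2) by auto
  then show ?case using Compl R by auto
next
  case (Union a)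
  have "(\<Union>i. a i) \<inter> R = (\<Union>i. a i \<inter> R)" by auto
  also have "\<dots> \<in> sets N" using Union by (intro sets.countable_UN) auto
  finally show ?case .
qed (use gen in auto)

lemma nat_filtration_eq: "nat_filtration \<Omega> T E X t = coord_sigma \<Omega> {s \<in> T. s \<le> t} E X"
  by (simp add: nat_filtration_def coord_sigma_def)

lemma filtration_inf_eq: "filtration_inf \<Omega> T (nat_filtration \<Omega> T E X) = coord_sigma \<Omega> T E X"
  unfolding filtration_inf_def
proof (subst coord_sigma_def, rule sigma_eqI)
  show "(\<Union>t\<in>T. sets (nat_filtration \<Omega> T E X t)) \<subseteq> Pow \<Omega>"
    using sets.sets_into_space unfolding nat_filtration_eq by fastforce
  show "{X s -` B \<inter> \<Omega> | s B. s \<in> T \<and> B \<in> sets E} \<subseteq> Pow \<Omega>" by auto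
  show "sigma_sets \<Omega> (\<Union>t\<in>T. sets (nat_filtration \<Omega> T E X t)) =
      sigma_sets \<Omega> {X s -` B \<inter> \<Omega> | s B. s \<in> T \<and> B \<in> sets E}"
  proof (rule sigma_sets_eqI)
    fix a assume "a \<in> (\<Union>t\<in>T. sets (nat_filtration \<Omega> T E X t))"
    then obtain t where "a \<in> sets (coord_sigma \<Omega> {s \<in> T. s \<le> t} E X)"
      by (auto simp: nat_filtration_eq)
    then have "a \<in> sets (coord_sigma \<Omega> T E X)"
      using coord_sigma_mono[of "{s \<in> T. s \<le> t}" T] by blast
    then show "a \<in> sigma_sets \<Omega> {X s -` B \<inter> \<Omega> | s B. s \<in> T \<and> B \<in> sets E}"
      by (simp add: sets_coord_sigma)
  next
    fix b assume "b \<in> {X s -` B \<inter> \<Omega> | s B. s \<in> T \<and> B \<in> sets E}"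
    then obtain s B where "b = X s -` B \<inter> \<Omega>" "s \<in> T" "B \<in> sets E" by blast
    then have "b \<in> sets (nat_filtration \<Omega> T E X s)"
      unfolding nat_filtration_eq by (simp add: coord_sigma_basic)
    then show "b \<in> sigma_sets \<Omega> (\<Union>t\<in>T. sets (nat_filtration \<Omega> T E X t))"
      using \<open>s \<in> T\<close> by blast
  qed
qed

lemma sets_nat_filtration_subset_inf:
  "sets (nat_filtration \<Omega> T E X t) \<subseteq> sets (filtration_inf \<Omega> T (nat_filtration \<Omega> T E X))"
  unfolding nat_filtration_eq filtration_inf_eq by (rule coord_sigma_mono) blast

lemma path_map_eq_iff: "path_map T X \<omega> = path_map T X \<omega>' \<longleftrightarrow> (\<forall>t\<in>T. X t \<omega> = X t \<omega>')"
proof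
  assume eq: "path_map T X \<omega> = path_map T X \<omega>'"
  show "\<forall>t\<in>T. X t \<omega> = X t \<omega>'"
  proof
    fix t assume "t \<in> T"
    then show "X t \<omega> = X t \<omega>'" using fun_cong[OF eq, of t] by (simp add: path_map_def)
  qed
qed (auto simp: path_map_def)

lemma path_map_space: "process \<Omega> T E X \<Longrightarrow> path_map T X \<in> \<Omega> \<rightarrow> space (path_space T E)"
  by (auto simp: process_def path_map_def space_PiM Pi_iff)

lemma measurable_path_mapI:
  "(\<And>t. t \<in> T \<Longrightarrow> X t \<in> M \<rightarrow>\<^sub>M E) \<Longrightarrow> path_map T X \<in> M \<rightarrow>\<^sub>M path_space T E"
  unfolding path_map_def[abs_def] by (rule measurable_restrict)

lemma space_sigma_of [simp]: "space (sigma_of \<Omega> T E X) = \<Omega>"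
  by (simp add: sigma_of_def)

lemma measurable_path_map_sigma_of:
  "process \<Omega> T E X \<Longrightarrow> path_map T X \<in> sigma_of \<Omega> T E X \<rightarrow>\<^sub>M path_space T E"
  unfolding sigma_of_def by (intro measurable_vimage_algebra1 path_map_space)

lemma measurable_sigma_of:
  assumes "process \<Omega> T E X" "t \<in> T"
  shows "X t \<in> sigma_of \<Omega> T E X \<rightarrow>\<^sub>M E"
proof -
  have "(\<lambda>\<omega>. path_map T X \<omega> t) \<in> sigma_of \<Omega> T E X \<rightarrow>\<^sub>M E"
    by (rule measurable_compose[OF measurable_path_map_sigma_of[OF assms(1)] measurable_component_singleton[OF assms(2)]])
  then show ?thesis using assms(2) by (simp add: path_map_def)
qed

section \<open>Processes stopped at a stopping time of their natural filtration\<close>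

locale stopped =
  fixes \<Omega> :: "'w set" and T :: "real set" and E :: "'e measure"
    and X :: "real \<Rightarrow> 'w \<Rightarrow> 'e" and S :: "'w \<Rightarrow> ereal"
  assumes X: "process \<Omega> T E X"
    and S: "stopping_time_on \<Omega> T (nat_filtration \<Omega> T E X) S"
begin

abbreviation "F \<equiv> nat_filtration \<Omega> T E X"
abbreviation "F_inf \<equiv> filtration_inf \<Omega> T F"
abbreviation "F_S \<equiv> stopped_sigma \<Omega> T F S"
abbreviation "XS \<equiv> stopped_process X S"

lemma space_F: "space (F t) = \<Omega>"
  by (simp add: nat_filtration_eq)

lemma sets_F_S: "sets F_S = {A \<in> sets F_inf. \<forall>t\<in>T. A \<inter> {\<omega> \<in> \<Omega>. S \<omega> \<le> ereal t} \<in> sets (F t)}"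
  by (rule sets_stopped_sigma[OF space_F S])

lemma space_F_S [simp]: "space F_S = \<Omega>"
  by (simp add: stopped_sigma_def space_measure_of_conv)

lemma S_cases [consumes 1, case_names fin inf]:
  assumes "\<omega> \<in> \<Omega>"
  obtains (fin) s where "s \<in> T" "S \<omega> = ereal s" | (inf) "S \<omega> = \<infinity>"
  using S assms by (auto simp: stopping_time_on_def random_time_def Pi_iff)

lemma S_le_sets: "t \<in> T \<Longrightarrow> {\<omega> \<in> \<Omega>. S \<omega> \<le> ereal t} \<in> sets (F t)"
  using S by (simp add: stopping_time_on_def)

lemma XS_before: "ereal t \<le> S \<omega> \<Longrightarrow> XS t \<omega> = X t \<omega>"
  by (simp add: stopped_process_def min_absorb2)

lemma XS_after: "S \<omega> = ereal s \<Longrightarrow> s \<le> t \<Longrightarrow> XS t \<omega> = X s \<omega>"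
  by (simp add: stopped_process_def min_absorb1)

lemma process_XS: "process \<Omega> T E XS"
  unfolding process_def
proof (intro ballI Pi_I)
  fix t \<omega> assume t: "t \<in> T" and \<omega>: "\<omega> \<in> \<Omega>"
  have Xsp: "X s \<omega> \<in> space E" if "s \<in> T" for s
    using X \<omega> that by (auto simp: process_def)
  show "XS t \<omega> \<in> space E"
  proof (cases "ereal t \<le> S \<omega>")
    case True
    then show ?thesis using Xsp[OF t] by (simp add: XS_before)
  next
    case False
    then obtain s where "s \<in> T" "S \<omega> = ereal s" "s \<le> t"
      using \<omega> by (auto elim!: S_cases)
    then show ?thesis using Xsp by (simp add: XS_after)
  qed
qed

text \<open>The two outcomes lie in the same atom of \<open>F\<^sub>t\<close> for every \<open>t \<le> S(\<omega>)\<close>.\<close>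
lemma agree_until_S:
  assumes \<omega>: "\<omega> \<in> \<Omega>" "\<omega>' \<in> \<Omega>" and eq: "\<And>s. s \<in> T \<Longrightarrow> ereal s \<le> S \<omega> \<Longrightarrow> X s \<omega> = X s \<omega>'"
  shows "S \<omega>' = S \<omega>" and "A \<in> sets F_S \<Longrightarrow> \<omega> \<in> A \<longleftrightarrow> \<omega>' \<in> A"
proof -
  have F_iff: "\<omega> \<in> B \<longleftrightarrow> \<omega>' \<in> B" if "B \<in> sets (F t)" "ereal t \<le> S \<omega>" for B t
    using that(1) \<omega> unfolding nat_filtration_eq
  proof (rule coord_sigma_mem_iff)
    fix s assume s: "s \<in> {s \<in> T. s \<le> t}"
    then have "ereal s \<le> S \<omega>" using that(2) by (auto intro: order_trans[of _ "ereal t"])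
    then show "X s \<omega> = X s \<omega>'" using eq s by simp
  qed
  have S_iff: "S \<omega> \<le> ereal t \<longleftrightarrow> S \<omega>' \<le> ereal t" if "t \<in> T" "ereal t \<le> S \<omega>" for t
    using F_iff[OF S_le_sets that(2)] that(1) \<omega> by simp
  \<comment> \<open>If \<open>S \<omega> = s\<close> is finite, the event \<open>S \<le> s\<close>
    forces \<open>S \<omega>' = s' \<le> s\<close>, and then the event \<open>S \<le> s'\<close>
    gives the reverse inequality. If \<open>S \<omega>\<close> is infinite, a finite value
    \<open>s\<close> at \<open>\<omega>'\<close> would put \<open>\<omega>\<close> into the event
    \<open>S \<le> s\<close>.\<close>
  show SS: "S \<omega>' = S \<omega>"
    using \<omega>(1)
  proof (cases rule: S_cases)
    case (fin s)
    then have "S \<omega>' \<le> ereal s" using S_iff[of s] by simp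
    then obtain s' where "s' \<in> T" "S \<omega>' = ereal s'" "s' \<le> s"
      using \<omega>(2) by (auto elim!: S_cases)
    then show ?thesis using S_iff[of s'] fin by simp
  next
    case inf
    show ?thesis
      using \<omega>(2)
    proof (cases rule: S_cases)
      case (fin s)
      then show ?thesis using S_iff[of s] inf by simp
    qed (use inf in simp)
  qed
  assume A: "A \<in> sets F_S"
  show "\<omega> \<in> A \<longleftrightarrow> \<omega>' \<in> A"
    using \<omega>(1)
  proof (cases rule: S_cases)
    case (fin s)
    then have "A \<inter> {\<omega> \<in> \<Omega>. S \<omega> \<le> ereal s} \<in> sets (F s)" using A by (simp add: sets_F_S)
    from F_iff[OF this] show ?thesis using fin \<omega> SS by simp
  next
    case inf
    have "A \<in> sets (coord_sigma \<Omega> T E X)" using A by (simp add: sets_F_S filtration_inf_eq)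
    then show ?thesis
      by (rule coord_sigma_mem_iff) (use \<omega> eq inf in auto)
  qed
qed

text \<open>By symmetry let \<open>S \<omega> \<le> S \<omega>'\<close>. Up to time
  \<open>S \<omega>\<close> neither path has been stopped, so equal stopped paths mean equal
  unstopped values there, and \<open>agree_until_S\<close> applies.\<close>

lemma F_S_mem_iff:
  assumes \<omega>: "\<omega> \<in> \<Omega>" "\<omega>' \<in> \<Omega>" and eq: "path_map T XS \<omega> = path_map T XS \<omega>'" and A: "A \<in> sets F_S"
  shows "\<omega> \<in> A \<longleftrightarrow> \<omega>' \<in> A"
  using \<omega> eq
proof (induction "S \<omega>" "S \<omega>'" arbitrary: \<omega> \<omega>' rule: linorder_wlog)
  case le
  have "X s \<omega> = X s \<omega>'" if "s \<in> T" "ereal s \<le> S \<omega>" for s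
  proof -
    have "XS s \<omega> = XS s \<omega>'" using le.prems(3) that(1) by (simp add: path_map_eq_iff)
    moreover have "ereal s \<le> S \<omega>'" using that(2) le.hyps by (rule order_trans)
    ultimately show ?thesis using that(2) by (simp add: XS_before)
  qed
  then show ?case using agree_until_S(2)[OF le.prems(1,2)] A by blast
next
  case sym
  then show ?case by metis
qed

lemma F_S_constant_on:
  assumes A: "A \<in> sets F_S" and C: "C \<subseteq> \<Omega>" "path_map T XS constant_on C"
  shows "(indicator A :: 'w \<Rightarrow> real) constant_on C"
proof -
  have "(indicator A x :: real) = indicator A y" if "x \<in> C" "y \<in> C" for x y
  proof -
    have "path_map T XS x = path_map T XS y" using C(2) that by (auto simp: constant_on_def)
    then show ?thesis using F_S_mem_iff[OF _ _ _ A] C(1) that by (auto simp: indicator_def)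
  qed
  then show ?thesis unfolding constant_on_def by metis
qed

text \<open>The field at the stopping time \<open>min t S\<close> is contained in
  \<open>F_S\<close>, because the event \<open>S \<le> s\<close> is contained in the event
  \<open>min t S \<le> s\<close>.\<close>

lemma measurable_path_map_XS_if_adapted:
  assumes "adapted T (stopped_filtration \<Omega> T F S) E XS"
  shows "path_map T XS \<in> F_S \<rightarrow>\<^sub>M path_space T E"
proof (rule measurable_path_mapI)
  fix t assume t: "t \<in> T"
  let ?S = "\<lambda>\<omega>. min (ereal t) (S \<omega>)"
  have "stopping_time_on \<Omega> T F ?S"
    unfolding stopping_time_on_def
  proof (intro conjI ballI)
    show "random_time \<Omega> T ?S"
      using S t by (auto simp: stopping_time_on_def random_time_def min_def Pi_iff)
    fix s assume "s \<in> T"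
    then show "{\<omega> \<in> \<Omega>. ?S \<omega> \<le> ereal s} \<in> sets (F s)"
      using S_le_sets[of s] sets.top[of "F s"] by (cases "t \<le> s") (simp_all add: min_le_iff_disj space_F)
  qed
  from sets_stopped_sigma[OF space_F this]
  have sets: "sets (stopped_filtration \<Omega> T F S t) =
      {A \<in> sets F_inf. \<forall>s\<in>T. A \<inter> {\<omega> \<in> \<Omega>. ?S \<omega> \<le> ereal s} \<in> sets (F s)}"
    by (simp add: stopped_filtration_def)
  have "sets (stopped_filtration \<Omega> T F S t) \<subseteq> sets F_S"
  proof
    fix A assume A: "A \<in> sets (stopped_filtration \<Omega> T F S t)"
    have "A \<inter> {\<omega> \<in> \<Omega>. S \<omega> \<le> ereal s} \<in> sets (F s)" if "s \<in> T" for s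
    proof -
      have "A \<inter> {\<omega> \<in> \<Omega>. S \<omega> \<le> ereal s} =
          A \<inter> {\<omega> \<in> \<Omega>. ?S \<omega> \<le> ereal s} \<inter> {\<omega> \<in> \<Omega>. S \<omega> \<le> ereal s}"
        by (auto simp: min_le_iff_disj)
      then show ?thesis using A S_le_sets[OF that] that by (simp add: sets sets.Int)
    qed
    then show "A \<in> sets F_S" using A by (simp add: sets sets_F_S)
  qed
  moreover have "space (stopped_filtration \<Omega> T F S t) = space F_S"
    by (simp add: stopped_filtration_def stopped_sigma_def space_measure_of_conv)
  moreover have "XS t \<in> stopped_filtration \<Omega> T F S t \<rightarrow>\<^sub>M E"
    using assms t by (simp add: adapted_def)
  ultimately show "XS t \<in> F_S \<rightarrow>\<^sub>M E" by (auto simp: measurable_def)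
qed

lemma sigma_of_subset_F_S:
  assumes "path_map T XS \<in> F_S \<rightarrow>\<^sub>M path_space T E"
  shows "sets (sigma_of \<Omega> T E XS) \<subseteq> sets F_S"
  unfolding sigma_of_def by (rule sets_image_in_sets[OF space_F_S assms])

text \<open>
  A map \<open>r\<close> that sends \<open>\<omega>\<close> to an outcome whose full path is the stopped path of \<open>\<omega>\<close> is measurable
  from \<open>\<sigma>(X\<^sup>S)\<close> to \<open>F\<^sub>\<infinity>\<close>, and it preserves membership in sets on which stopped paths decide.
\<close>
lemma sigma_of_if_Im_subset:
  assumes Im: "path_map T XS ` \<Omega> \<subseteq> path_map T X ` \<Omega>"
    and A: "A \<in> sets F_inf" "A \<subseteq> \<Omega>"
    and const: "\<And>\<omega> \<omega>'. \<omega> \<in> \<Omega> \<Longrightarrow> \<omega>' \<in> \<Omega> \<Longrightarrow> path_map T XS \<omega> = path_map T XS \<omega>' \<Longrightarrow> \<omega> \<in> A \<longleftrightarrow> \<omega>' \<in> A"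
  shows "A \<in> sets (sigma_of \<Omega> T E XS)"
proof -
  have "\<forall>\<omega>\<in>\<Omega>. \<exists>\<omega>'\<in>\<Omega>. path_map T X \<omega>' = path_map T XS \<omega>"
    using Im by (metis imageE image_eqI subsetD)
  then obtain r where r: "\<And>\<omega>. \<omega> \<in> \<Omega> \<Longrightarrow> r \<omega> \<in> \<Omega>"
      "\<And>\<omega>. \<omega> \<in> \<Omega> \<Longrightarrow> path_map T X (r \<omega>) = path_map T XS \<omega>"
    by metis
  have Xr: "X t (r \<omega>) = XS t \<omega>" if "\<omega> \<in> \<Omega>" "t \<in> T" for \<omega> t
    using fun_cong[OF r(2)[OF that(1)], of t] that(2) by (simp only: path_map_def restrict_apply' if_True)
  \<comment> \<open>The map \<open>r\<close> comes from the axiom of choice; its measurability rests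
    on \<open>X s\<close> composed with \<open>r\<close> being \<open>XS s\<close>, checked on
    generators.\<close>
  have "r \<in> sigma_of \<Omega> T E XS \<rightarrow>\<^sub>M coord_sigma \<Omega> T E X"
    unfolding coord_sigma_def
  proof (rule measurable_measure_of)
    show "r \<in> space (sigma_of \<Omega> T E XS) \<rightarrow> \<Omega>" using r(1) by simp
    fix b assume "b \<in> {X s -` B \<inter> \<Omega> | s B. s \<in> T \<and> B \<in> sets E}"
    then obtain s B where sB: "b = X s -` B \<inter> \<Omega>" "s \<in> T" "B \<in> sets E" by blast
    then have "r -` b \<inter> space (sigma_of \<Omega> T E XS) = XS s -` B \<inter> space (sigma_of \<Omega> T E XS)"
      using r(1) Xr by auto
    then show "r -` b \<inter> space (sigma_of \<Omega> T E XS) \<in> sets (sigma_of \<Omega> T E XS)"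
      using measurable_sets[OF measurable_sigma_of[OF process_XS sB(2)] sB(3)] by simp
  qed auto
  then have "r -` A \<inter> \<Omega> \<in> sets (sigma_of \<Omega> T E XS)"
    using A(1) unfolding filtration_inf_eq by (metis measurable_sets space_sigma_of)
  moreover have "r -` A \<inter> \<Omega> = A"
  proof -
    have "r \<omega> \<in> A \<longleftrightarrow> \<omega> \<in> A" if \<omega>: "\<omega> \<in> \<Omega>" for \<omega>
    proof -
      \<comment> \<open>The full path of \<open>r \<omega>\<close> follows that of
        \<open>\<omega>\<close> up to \<open>S \<omega>\<close>, so both stop at the same time.
        Consequently their stopped paths coincide, and \<open>const\<close> applies.\<close>
      have "S (r \<omega>) = S \<omega>"
      proof (rule agree_until_S(1)[OF \<omega> r(1)[OF \<omega>]])
        fix s assume "s \<in> T" "ereal s \<le> S \<omega>"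
        then show "X s \<omega> = X s (r \<omega>)" using Xr[OF \<omega>] by (simp add: XS_before)
      qed
      have "XS t (r \<omega>) = XS t \<omega>" if t: "t \<in> T" for t
      proof (cases "ereal t \<le> S \<omega>")
        case True
        then show ?thesis using \<open>S (r \<omega>) = S \<omega>\<close> Xr[OF \<omega> t] XS_before[of t "r \<omega>"] by simp
      next
        case False
        then obtain s where s: "s \<in> T" "S \<omega> = ereal s" "s \<le> t"
          using \<omega> by (auto elim!: S_cases)
        then have "XS t (r \<omega>) = X s (r \<omega>)" using \<open>S (r \<omega>) = S \<omega>\<close> by (simp add: XS_after)
        also have "\<dots> = XS s \<omega>" using Xr[OF \<omega> s(1)] .
        finally show ?thesis using s by (simp add: XS_after)
      qed
      then show ?thesis using const[OF r(1)[OF \<omega>] \<omega>] by (simp add: path_map_eq_iff)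
    qed
    then show ?thesis using A(2) by blast
  qed
  ultimately show ?thesis by simp
qed

text \<open>Outcomes not separated by the countably many generators have stopped paths in the same
  atom of the image space. The Hausdorff condition makes these paths equal, which gives the
  saturation hypothesis of \<open>Blackwell_sigma_sets\<close>.\<close>

lemma sigma_of_if_Blackwell:
  assumes G: "space G = \<Omega>" "sets F_inf \<subseteq> sets G" "Blackwell_measurable G"
    and sep: "separable_measurable (sigma_of \<Omega> T E XS)"
    and Haus: "Hausdorff_measurable (restrict_space (path_space T E) (path_map T XS ` \<Omega>))"
    and sub: "sets (sigma_of \<Omega> T E XS) \<subseteq> sets F_inf"
    and A: "A \<in> sets F_inf"
    and const: "\<And>\<omega> \<omega>'. \<omega> \<in> \<Omega> \<Longrightarrow> \<omega>' \<in> \<Omega> \<Longrightarrow> path_map T XS \<omega> = path_map T XS \<omega>' \<Longrightarrow> \<omega> \<in> A \<longleftrightarrow> \<omega>' \<in> A"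
  shows "A \<in> sets (sigma_of \<Omega> T E XS)"
proof -
  obtain C where C: "countable C" "C \<subseteq> Pow \<Omega>" "sets (sigma_of \<Omega> T E XS) = sigma_sets \<Omega> C"
    using sep by (auto simp: separable_measurable_def)
  have CG: "C \<subseteq> sets G" using C(3) sub G(2) by blast
  have "A \<in> sigma_sets (space G) C"
  proof (rule Blackwell_sigma_sets[OF G(3) C(1) CG])
    show "A \<in> sets G" using A G(2) by blast
    fix x y assume xy: "x \<in> space G" "y \<in> space G" "\<And>c. c \<in> C \<Longrightarrow> x \<in> c \<longleftrightarrow> y \<in> c"
    then have x: "x \<in> \<Omega>" and y: "y \<in> \<Omega>" using G(1) by auto
    let ?p = "path_map T XS x" and ?q = "path_map T XS y"
    let ?R = "restrict_space (path_space T E) (path_map T XS ` \<Omega>)"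
    have "?p \<in> B \<longleftrightarrow> ?q \<in> B" if "B \<in> sets (path_space T E)" for B
    proof -
      have "path_map T XS -` B \<inter> \<Omega> \<in> sigma_sets \<Omega> C"
        unfolding C(3)[symmetric] sigma_of_def using that by (rule in_vimage_algebra)
      from sigma_sets_mem_iff[OF this xy(3) x y] show ?thesis using x y by simp
    qed
    then have "?p \<in> B \<longleftrightarrow> ?q \<in> B" if "B \<in> sets ?R" for B
      using that x y by (auto simp: sets_restrict_space)
    moreover have "?p \<in> space ?R" "?q \<in> space ?R"
      using path_map_space[OF process_XS] x y by (auto simp: space_restrict_space Pi_iff)
    ultimately have rel: "?p \<in> atom_rel ?R `` {?p}" "?q \<in> atom_rel ?R `` {?p}"
      by (auto simp: atom_rel_def indicator_def)
    moreover have "atom_rel ?R `` {?p} \<in> atoms ?R"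
      unfolding atoms_def using \<open>?p \<in> space ?R\<close> by (rule quotientI)
    ultimately obtain z where "atom_rel ?R `` {?p} = {z}"
      using Haus unfolding Hausdorff_measurable_def by blast
    then have "?p = ?q" using rel by (metis singletonD)
    then show "x \<in> A \<longleftrightarrow> y \<in> A" using const[OF x y] by simp
  qed
  then show ?thesis using C(3) G(1) by simp
qed

text \<open>Since \<open>S\<close> has countably many values, events of \<open>XS\<close> split into
  events of \<open>X\<close> on the sets where \<open>S\<close> is constant. Conversely, sets of
  \<open>F_S\<close> are split in the same way, once these sets are known to lie in
  \<open>sigma_of\<close>.\<close>

lemma sigma_of_eq_F_S_Nats:
  assumes N: "T = \<nat>"
  shows "sets (sigma_of \<Omega> T E XS) = sets F_S"
proof
  have nT: "real n \<in> T" for n using N by simp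
  let ?H = "sigma_of \<Omega> T E XS"
  let ?L = "\<lambda>n. {\<omega> \<in> \<Omega>. S \<omega> \<le> ereal (real n)}" and ?U = "\<lambda>n. {\<omega> \<in> \<Omega>. ereal (real n) \<le> S \<omega>}"
  have S_nat: "(\<exists>n. S \<omega> = ereal (real n)) \<or> S \<omega> = \<infinity>" if "\<omega> \<in> \<Omega>" for \<omega>
    using that N by (auto elim!: S_cases simp: Nats_def)
  have mono: "sets (F (real m)) \<subseteq> sets (F (real n))" if "m \<le> n" for m n
    unfolding nat_filtration_eq using that by (intro coord_sigma_mono) auto
  show "sets ?H \<subseteq> sets F_S"
  proof (rule sigma_of_subset_F_S[OF measurable_path_mapI])
    fix t assume t: "t \<in> T"
    have "XS t -` B \<inter> \<Omega> \<in> sets F_S" if B: "B \<in> sets E" for B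
    proof -
      \<comment> \<open>The part of the event on \<open>S = k\<close>, where \<open>XS t\<close> is
        \<open>X\<close> at time \<open>min k t\<close>. Writing \<open>S = k\<close> through the
        sets \<open>?L j\<close> with \<open>j \<le> k\<close> shows that \<open>V k\<close> lies in
        \<open>F k\<close>.\<close>
      define V where "V k = (X (min (real k) t) -` B \<inter> \<Omega>) \<inter> (?L k - (\<Union>j<k. ?L j))" for k
      have S_eq: "\<omega> \<in> ?L k - (\<Union>j<k. ?L j) \<longleftrightarrow> \<omega> \<in> \<Omega> \<and> S \<omega> = ereal (real k)" for \<omega> k
      proof
        assume L: "\<omega> \<in> ?L k - (\<Union>j<k. ?L j)"
        then obtain n where n: "S \<omega> = ereal (real n)" using S_nat[of \<omega>] by auto
        then have "n \<le> k" "\<not> n < k" using L by auto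
        then show "\<omega> \<in> \<Omega> \<and> S \<omega> = ereal (real k)" using n L by simp
      qed auto
      have V: "V k = {\<omega> \<in> \<Omega>. S \<omega> = ereal (real k) \<and> XS t \<omega> \<in> B}" for k
      proof -
        have "XS t \<omega> = X (min (real k) t) \<omega>" if "S \<omega> = ereal (real k)" for \<omega>
          using that by (simp add: stopped_process_def min_def)
        moreover have "?L k - (\<Union>j<k. ?L j) = {\<omega> \<in> \<Omega>. S \<omega> = ereal (real k)}"
          using S_eq by blast
        ultimately show ?thesis unfolding V_def by auto
      qed
      have Vk: "V k \<in> sets (F (real k))" for k
      proof -
        have "min (real k) t \<in> {s \<in> T. s \<le> real k}" using t nT[of k] by (auto simp: min_def)
        then have "X (min (real k) t) -` B \<inter> \<Omega> \<in> sets (F (real k))"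
          unfolding nat_filtration_eq by (rule coord_sigma_basic[OF _ B])
        moreover have "?L j \<in> sets (F (real k))" if "j \<le> k" for j
          using S_le_sets[OF nT[of j]] mono[OF that] by blast
        ultimately show ?thesis
          unfolding V_def by (intro sets.Int[of "_ \<inter> _"] sets.Diff sets.finite_UN) auto
      qed
      \<comment> \<open>The remainder lives on \<open>S = \<infinity>\<close>, where
        \<open>XS t = X t\<close>. Membership in \<open>F_inf\<close> is enough for it, because it
        misses every event \<open>S \<le> s\<close>.\<close>
      have "XS t -` B \<inter> \<Omega> = (\<Union>k. V k) \<union> (X t -` B \<inter> \<Omega> - (\<Union>k. ?L k))"
      proof -
        have "XS t \<omega> \<in> B \<longleftrightarrow> (\<exists>k. S \<omega> = ereal (real k) \<and> XS t \<omega> \<in> B) \<or>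
            X t \<omega> \<in> B \<and> (\<forall>k. \<not> S \<omega> \<le> ereal (real k))" if "\<omega> \<in> \<Omega>" for \<omega>
          using S_nat[OF that]
        proof
          assume "\<exists>n. S \<omega> = ereal (real n)"
          then show ?thesis by auto
        next
          assume "S \<omega> = \<infinity>"
          then show ?thesis by (simp add: XS_before)
        qed
        then show ?thesis unfolding V by blast
      qed
      moreover have "V k \<in> sets F_inf" "?L k \<in> sets F_inf" for k
        using Vk S_le_sets[OF nT] sets_nat_filtration_subset_inf by blast+
      moreover have "X t -` B \<inter> \<Omega> \<in> sets F_inf"
        unfolding filtration_inf_eq by (rule coord_sigma_basic[OF t B])
      ultimately have "XS t -` B \<inter> \<Omega> \<in> sets F_inf" by auto
      moreover have "(XS t -` B \<inter> \<Omega>) \<inter> {\<omega> \<in> \<Omega>. S \<omega> \<le> ereal s} \<in> sets (F s)" if "s \<in> T" for s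
      proof -
        obtain n where s: "s = real n" using \<open>s \<in> T\<close> N by (auto simp: Nats_def)
        have "(XS t -` B \<inter> \<Omega>) \<inter> ?L n = (\<Union>k\<le>n. V k)"
        proof (intro equalityI subsetI)
          fix \<omega> assume \<omega>: "\<omega> \<in> (XS t -` B \<inter> \<Omega>) \<inter> ?L n"
          then obtain k where "S \<omega> = ereal (real k)" using S_nat[of \<omega>] by auto
          then show "\<omega> \<in> (\<Union>k\<le>n. V k)" using \<omega> unfolding V by auto
        qed (auto simp: V)
        moreover have "(\<Union>k\<le>n. V k) \<in> sets (F (real n))"
          using Vk mono by (intro sets.finite_UN) auto
        ultimately show ?thesis using s by simp
      qed
      ultimately show ?thesis by (simp add: sets_F_S)
    qed
    then show "XS t \<in> F_S \<rightarrow>\<^sub>M E"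
      using process_XS t by (auto simp: measurable_def process_def)
  qed
  \<comment> \<open>On \<open>R\<close> the process has not been stopped before any time in
    \<open>I\<close>, so \<open>X s\<close> can be replaced by \<open>XS s\<close> in the
    generators.\<close>
  have trace: "A \<inter> R \<in> sets ?H"
    if "A \<in> sets (coord_sigma \<Omega> I E X)" "I \<subseteq> T" "R \<in> sets ?H" "\<And>\<omega> s. \<omega> \<in> R \<Longrightarrow> s \<in> I \<Longrightarrow> ereal s \<le> S \<omega>"
    for A I R
    using that(1)
  proof (rule coord_sigma_Int[OF _ that(3)])
    show "R \<subseteq> \<Omega>" using sets.sets_into_space[OF that(3)] by simp
    fix s B assume s: "s \<in> I" "B \<in> sets E"
    have "XS s -` B \<inter> space ?H \<in> sets ?H"
      using that(2) s by (intro measurable_sets[OF measurable_sigma_of[OF process_XS]]) auto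
    moreover have "(X s -` B \<inter> \<Omega>) \<inter> R = (XS s -` B \<inter> space ?H) \<inter> R"
      using XS_before[OF that(4)[OF _ s(1)]] by auto
    ultimately show "(X s -` B \<inter> \<Omega>) \<inter> R \<in> sets ?H" using that(3) by auto
  qed
  have trace_F: "A \<inter> ?U n \<in> sets ?H" if "A \<in> sets (F (real n))" "?U n \<in> sets ?H" for A n
    using that(1) unfolding nat_filtration_eq
    by (rule trace[OF _ _ that(2)]) (auto intro: order_trans[rotated])
  \<comment> \<open>The event \<open>S \<le> n\<close> lies in \<open>F n\<close>, so its trace on
    \<open>?U n\<close> is in \<open>?H\<close> by the induction hypothesis; removing that trace
    from \<open>?U n\<close> leaves \<open>?U (Suc n)\<close>.\<close>
  have U: "?U n \<in> sets ?H" for n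
  proof (induction n)
    case 0
    have "?U 0 = \<Omega>" using S_nat by force
    then show ?case using sets.top[of ?H] by simp
  next
    case (Suc n)
    have "?U (Suc n) = ?U n - ?L n \<inter> ?U n"
    proof (intro equalityI subsetI)
      fix \<omega> assume "\<omega> \<in> ?U n - ?L n \<inter> ?U n"
      then show "\<omega> \<in> ?U (Suc n)" using S_nat[of \<omega>] by auto
    next
      fix \<omega> assume "\<omega> \<in> ?U (Suc n)"
      then show "\<omega> \<in> ?U n - ?L n \<inter> ?U n" using S_nat[of \<omega>] by auto
    qed
    moreover have "?L n \<inter> ?U n \<in> sets ?H"
      by (rule trace_F[OF S_le_sets[OF nT] Suc])
    ultimately show ?case using Suc by simp
  qed
  show "sets F_S \<subseteq> sets ?H"
  proof
    fix A assume A: "A \<in> sets F_S"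
    then have "A \<subseteq> \<Omega>" using sets.sets_into_space by fastforce
    have fin: "A \<inter> ?L n \<inter> ?U n \<in> sets ?H" for n
      using A nT[of n] by (intro trace_F U) (simp add: sets_F_S)
    \<comment> \<open>This is the part on \<open>S = \<infinity>\<close>: every time in
      \<open>T\<close> precedes stopping, so the trace argument applies with
      \<open>I = T\<close>.\<close>
    have "A \<inter> (\<Inter>n. ?U n) \<in> sets ?H"
    proof (rule trace[of _ T])
      show "A \<in> sets (coord_sigma \<Omega> T E X)" using A by (simp add: sets_F_S filtration_inf_eq)
      show "(\<Inter>n. ?U n) \<in> sets ?H" using U by (intro sets.countable_INT) auto
      fix \<omega> s assume "\<omega> \<in> (\<Inter>n. ?U n)" "s \<in> T"
      then show "ereal s \<le> S \<omega>" using N by (auto simp: Nats_def)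
    qed simp
    moreover have A_eq: "A = (\<Union>n. A \<inter> ?L n \<inter> ?U n) \<union> A \<inter> (\<Inter>n. ?U n)"
    proof (intro equalityI subsetI)
      fix \<omega> assume "\<omega> \<in> A"
      moreover from this have "\<omega> \<in> \<Omega>" using \<open>A \<subseteq> \<Omega>\<close> by blast
      moreover from S_nat[OF this] have "(\<exists>n. S \<omega> = ereal (real n)) \<or> S \<omega> = \<infinity>" .
      ultimately show "\<omega> \<in> (\<Union>n. A \<inter> ?L n \<inter> ?U n) \<union> A \<inter> (\<Inter>n. ?U n)" by force
    qed auto
    moreover have "(\<Union>n. A \<inter> ?L n \<inter> ?U n) \<in> sets ?H" using fin by blast
    ultimately show "A \<in> sets ?H" by (subst A_eq) (rule sets.Un)
  qed
qed

end

section \<open>Equivalence of the descriptions of the stopped sigma-field\<close>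

theorem theorem7p9:
  fixes \<Omega> :: "'w set" and T :: "real set" and E :: "'e measure"
    and X :: "real \<Rightarrow> 'w \<Rightarrow> 'e" and S :: "'w \<Rightarrow> ereal"
  assumes T: "T = \<nat> \<or> T = {0..}"
    and X: "process \<Omega> T E X"
    and S: "stopping_time_on \<Omega> T (nat_filtration \<Omega> T E X) S"
  shows "let F = nat_filtration \<Omega> T E X;
             F_inf = filtration_inf \<Omega> T F;
             F_S = stopped_sigma \<Omega> T F S;
             XS = stopped_process X S;
             Im_X = path_map T X ` \<Omega>;
             Im_XS = path_map T XS ` \<Omega>
    in (T = \<nat> \<longrightarrow> sets (sigma_of \<Omega> T E XS) = sets F_S) \<and>
       (adapted T (stopped_filtration \<Omega> T F S) E XS \<longrightarrow> path_map T XS \<in> F_S \<rightarrow>\<^sub>M path_space T E) \<and>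
       (path_map T XS \<in> F_S \<rightarrow>\<^sub>M path_space T E \<and>
        (Im_XS \<subseteq> Im_X \<or>
         (\<exists>G. space G = \<Omega> \<and> sets F_inf \<subseteq> sets G \<and> Blackwell_measurable G) \<and>
         separable_measurable (sigma_of \<Omega> T E XS) \<and>
         Hausdorff_measurable (restrict_space (path_space T E) Im_XS)) \<longrightarrow>
        (\<forall>A. A \<subseteq> \<Omega> \<longrightarrow>
          (A \<in> sets F_S \<longleftrightarrow>
             (\<forall>C. C \<subseteq> \<Omega> \<and> path_map T XS constant_on C \<longrightarrow>
                  (indicator A :: 'w \<Rightarrow> real) constant_on C) \<and>
             A \<in> sets F_inf) \<and>
          (A \<in> sets F_S \<longleftrightarrow> A \<in> sets (sigma_of \<Omega> T E XS))))"
proof -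
  interpret stopped \<Omega> T E X S using X S by unfold_locales
  have equiv: "(A \<in> sets F_S \<longleftrightarrow>
        (\<forall>C. C \<subseteq> \<Omega> \<and> path_map T XS constant_on C \<longrightarrow> (indicator A :: 'w \<Rightarrow> real) constant_on C) \<and>
        A \<in> sets F_inf) \<and>
      (A \<in> sets F_S \<longleftrightarrow> A \<in> sets (sigma_of \<Omega> T E XS))"
    if meas: "path_map T XS \<in> F_S \<rightarrow>\<^sub>M path_space T E"
      and or: "path_map T XS ` \<Omega> \<subseteq> path_map T X ` \<Omega> \<or>
         (\<exists>G. space G = \<Omega> \<and> sets F_inf \<subseteq> sets G \<and> Blackwell_measurable G) \<and>
         separable_measurable (sigma_of \<Omega> T E XS) \<and>
         Hausdorff_measurable (restrict_space (path_space T E) (path_map T XS ` \<Omega>))"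
      and A: "A \<subseteq> \<Omega>" for A
  proof -
    have i_ii: "(indicator A :: 'w \<Rightarrow> real) constant_on C"
      if "A \<in> sets F_S" "C \<subseteq> \<Omega>" "path_map T XS constant_on C" for C
      by (rule F_S_constant_on[OF that])
    have F_S_inf: "sets F_S \<subseteq> sets F_inf" by (auto simp: sets_F_S)
    have iii_i: "sets (sigma_of \<Omega> T E XS) \<subseteq> sets F_S" by (rule sigma_of_subset_F_S[OF meas])
    have ii_iii: "A \<in> sets (sigma_of \<Omega> T E XS)"
      if c: "\<And>C. C \<subseteq> \<Omega> \<Longrightarrow> path_map T XS constant_on C \<Longrightarrow> (indicator A :: 'w \<Rightarrow> real) constant_on C"
        and "A \<in> sets F_inf"
    proof -
      have const: "\<omega> \<in> A \<longleftrightarrow> \<omega>' \<in> A"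
        if "\<omega> \<in> \<Omega>" "\<omega>' \<in> \<Omega>" "path_map T XS \<omega> = path_map T XS \<omega>'" for \<omega> \<omega>'
      proof -
        \<comment> \<open>Testing condition (ii) on two-point sets shows that the stopped path
          decides membership in \<open>A\<close>.\<close>
        have "(indicator A :: 'w \<Rightarrow> real) constant_on {\<omega>, \<omega>'}"
          using that by (intro c) (auto simp: constant_on_def)
        then have "indicator A \<omega> = (indicator A \<omega>' :: real)" by (auto simp: constant_on_def)
        then show ?thesis by (auto simp: indicator_def split: if_splits)
      qed
      from or show ?thesis
      proof (elim disjE conjE exE)
        assume "path_map T XS ` \<Omega> \<subseteq> path_map T X ` \<Omega>"
        then show ?thesis using \<open>A \<in> sets F_inf\<close> A const by (rule sigma_of_if_Im_subset)
      next
        fix G assume "space G = \<Omega>" "sets F_inf \<subseteq> sets G" "Blackwell_measurable G"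
          "separable_measurable (sigma_of \<Omega> T E XS)"
          "Hausdorff_measurable (restrict_space (path_space T E) (path_map T XS ` \<Omega>))"
        then show ?thesis
          using subset_trans[OF iii_i F_S_inf] \<open>A \<in> sets F_inf\<close> const by (rule sigma_of_if_Blackwell)
      qed
    qed
    \<comment> \<open>The cycle (i) to (ii) to (iii) to (i) is complete; the alternative (G1) or
      (G2) enters in the step from (ii) to (iii).\<close>
    show ?thesis using i_ii F_S_inf iii_i ii_iii by blast
  qed
  show ?thesis
    unfolding Let_def
    using sigma_of_eq_F_S_Nats measurable_path_map_XS_if_adapted equiv by blast
qed

end
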